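(* Let $0<\alpha<1$ and let $A$ be an injective selfadjoint operator in a separable Hilbert space $H$. Let $x\in D(A^{-1})$, $F\in L^\infty((0,\infty);H)$, and let $u$ be the mild solution on $[0,\infty)$ of $$iD_t^\alpha u+Au+F(t)=0\quad(t>0),\qquad u(0)=x.$$ If there exists $F_0\in D(A^{-1})$ such that $$\lim_{t\to\infty}\int_0^t(t-\tau)^{\alpha-1}\|F(\tau)-F_0\|_H\,d\tau=0,$$ then $$\lim_{t\to\infty}u(t)=-A^{-1}F_0$$ (limit in $H$).
   Context: $D(A^{-1})=R(A)$ is the range of $A$. $D_t^\alpha$ is the Caputo derivative. $E_{\alpha,\beta}(z)=\sum_{k\ge0}z^k/\Gamma(\alpha k+\beta)$. By the spectral theorem fix a finite measure space $(\Omega,\mu)$, a unitary $U:L^2(\Omega)\to H$ and a real-valued function $a(\xi)$ on $\Omega$, finite a.e., such that $A$ is unitarily equivalent via $U$ to multiplication by $a$: $\psi\in D(A)$ iff $aU^{-1}\psi\in L^2(\Omega)$, and $A\psi=U(a(\xi)U^{-1}\psi)$. Define for $t\ge0$ (resp. $t>0$) $$S_t\phi=U\big(E_{\alpha,1}(ia(\xi)t^\alpha)U^{-1}\phi\big),\qquad P_t\phi=U\big(t^{\alpha-1}E_{\alpha,\alpha}(ia(\xi)t^\alpha)U^{-1}\phi\big),$$ and $Gv(t)=\int_0^tP_{t-\tau}v(\tau)\,d\tau$. The mild solution of the linear problem on $[0,\infty)$ is $u(t)=S_tx+iGF(t)$, $u\in C([0,\infty);H)$. *)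

theory Defs
  imports "HOL-Analysis.Analysis"
begin

(* Complex Hilbert spaces.  The inner product is linear in the first argument;
   its positivity and the homogeneity of the norm under scaleC follow from
   cinner_self.  Completeness and the real structure come from class banach. *)
class complex_hilbert = banach +
  fixes scaleC :: "complex \<Rightarrow> 'a \<Rightarrow> 'a" (infixr "*\<^sub>C" 75)
    and cinner :: "'a \<Rightarrow> 'a \<Rightarrow> complex"
  assumes scaleC_of_real: "complex_of_real r *\<^sub>C x = r *\<^sub>R x"
    and scaleC_add_right: "c *\<^sub>C (x + y) = c *\<^sub>C x + c *\<^sub>C y"
    and scaleC_add_left: "(c + d) *\<^sub>C x = c *\<^sub>C x + d *\<^sub>C x"
    and scaleC_scaleC: "c *\<^sub>C d *\<^sub>C x = (c * d) *\<^sub>C x"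
    and cinner_commute: "cinner x y = cnj (cinner y x)"
    and cinner_add_left: "cinner (x + y) z = cinner x z + cinner y z"
    and cinner_scaleC_left: "cinner (c *\<^sub>C x) y = c * cinner x y"
    and cinner_self: "cinner x x = complex_of_real ((norm x)\<^sup>2)"

instantiation complex :: complex_hilbert
begin

definition scaleC_complex :: "complex \<Rightarrow> complex \<Rightarrow> complex"
  where "scaleC_complex c x = c * x"

definition cinner_complex :: "complex \<Rightarrow> complex \<Rightarrow> complex"
  where "cinner_complex x y = x * cnj y"

instance
proof
  fix c d x y z :: complex and r :: real
  show "complex_of_real r *\<^sub>C x = r *\<^sub>R x"
    by (simp add: scaleC_complex_def scaleR_conv_of_real)
  show "cinner x x = complex_of_real ((norm x)\<^sup>2)"
    unfolding cinner_complex_def using complex_norm_square [of x] by simp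
qed (simp_all add: scaleC_complex_def cinner_complex_def distrib_left distrib_right)

end

(* An unbounded operator is a pair of a domain D and a function A; the values
   of A outside D play no role. *)

definition linear_operator_on :: "'h::complex_hilbert set \<Rightarrow> ('h \<Rightarrow> 'h) \<Rightarrow> bool"
  where "linear_operator_on D A \<longleftrightarrow>
    0 \<in> D \<and>
    (\<forall>x\<in>D. \<forall>y\<in>D. x + y \<in> D \<and> A (x + y) = A x + A y) \<and>
    (\<forall>c. \<forall>x\<in>D. c *\<^sub>C x \<in> D \<and> A (c *\<^sub>C x) = c *\<^sub>C A x)"

definition adjoint_graph :: "'h::complex_hilbert set \<Rightarrow> ('h \<Rightarrow> 'h) \<Rightarrow> ('h \<times> 'h) set"
  where "adjoint_graph D A = {(y, z). \<forall>x\<in>D. cinner (A x) y = cinner x z}"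

definition selfadjoint_on :: "'h::complex_hilbert set \<Rightarrow> ('h \<Rightarrow> 'h) \<Rightarrow> bool"
  where "selfadjoint_on D A \<longleftrightarrow>
    linear_operator_on D A \<and> closure D = UNIV \<and> adjoint_graph D A = {(y, A y) | y. y \<in> D}"

(* Elements of L^2 are handled through representing functions. *)
definition L2 :: "'w measure \<Rightarrow> ('w \<Rightarrow> complex) set"
  where "L2 M = {f \<in> borel_measurable M. integrable M (\<lambda>\<xi>. (norm (f \<xi>))\<^sup>2)}"

(* Preservation of the inner product together with linearity forces U to be
   constant on classes of a.e. equal functions, and U f = U g to imply f = g a.e. *)
definition unitary_L2 :: "'w measure \<Rightarrow> (('w \<Rightarrow> complex) \<Rightarrow> 'h::complex_hilbert) \<Rightarrow> bool"
  where "unitary_L2 M U \<longleftrightarrow>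
    (\<forall>f\<in>L2 M. \<forall>g\<in>L2 M. U (\<lambda>\<xi>. f \<xi> + g \<xi>) = U f + U g) \<and>
    (\<forall>c. \<forall>f\<in>L2 M. U (\<lambda>\<xi>. c * f \<xi>) = c *\<^sub>C U f) \<and>
    (\<forall>f\<in>L2 M. \<forall>g\<in>L2 M. cinner (U f) (U g) = (LINT \<xi>|M. f \<xi> * cnj (g \<xi>))) \<and>
    U ` L2 M = UNIV"

(* A representative of the inverse image under U; it is determined up to a
   null set. *)
definition Uinv :: "'w measure \<Rightarrow> (('w \<Rightarrow> complex) \<Rightarrow> 'h) \<Rightarrow> 'h \<Rightarrow> 'w \<Rightarrow> complex"
  where "Uinv M U \<phi> = inv_into (L2 M) U \<phi>"

definition spectral_representation ::
  "'w measure \<Rightarrow> (('w \<Rightarrow> complex) \<Rightarrow> 'h::complex_hilbert) \<Rightarrow> ('w \<Rightarrow> real) \<Rightarrow> 'h set \<Rightarrow> ('h \<Rightarrow> 'h) \<Rightarrow> bool"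
  where "spectral_representation M U a D A \<longleftrightarrow>
    finite_measure M \<and> unitary_L2 M U \<and> a \<in> borel_measurable M \<and>
    (\<forall>\<psi>. \<psi> \<in> D \<longleftrightarrow> (\<lambda>\<xi>. complex_of_real (a \<xi>) * Uinv M U \<psi> \<xi>) \<in> L2 M) \<and>
    (\<forall>\<psi>\<in>D. A \<psi> = U (\<lambda>\<xi>. complex_of_real (a \<xi>) * Uinv M U \<psi> \<xi>))"

definition mittag_leffler :: "real \<Rightarrow> real \<Rightarrow> complex \<Rightarrow> complex"
  where "mittag_leffler \<alpha> \<beta> z = (\<Sum>k. z ^ k / complex_of_real (Gamma (\<alpha> * real k + \<beta>)))"

definition S_op ::
  "'w measure \<Rightarrow> (('w \<Rightarrow> complex) \<Rightarrow> 'h) \<Rightarrow> ('w \<Rightarrow> real) \<Rightarrow> real \<Rightarrow> real \<Rightarrow> 'h \<Rightarrow> 'h"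
  where "S_op M U a \<alpha> t \<phi> =
    U (\<lambda>\<xi>. mittag_leffler \<alpha> 1 (\<i> * complex_of_real (a \<xi> * t powr \<alpha>)) * Uinv M U \<phi> \<xi>)"

definition P_op ::
  "'w measure \<Rightarrow> (('w \<Rightarrow> complex) \<Rightarrow> 'h) \<Rightarrow> ('w \<Rightarrow> real) \<Rightarrow> real \<Rightarrow> real \<Rightarrow> 'h \<Rightarrow> 'h"
  where "P_op M U a \<alpha> t \<phi> =
    U (\<lambda>\<xi>. complex_of_real (t powr (\<alpha> - 1)) *
           mittag_leffler \<alpha> \<alpha> (\<i> * complex_of_real (a \<xi> * t powr \<alpha>)) * Uinv M U \<phi> \<xi>)"

(* For metric spaces, second countability is separability; it is the form in
   which the Bochner integral requires it. *)
definition G_op ::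
  "'w measure \<Rightarrow> (('w \<Rightarrow> complex) \<Rightarrow> 'h::{complex_hilbert, second_countable_topology}) \<Rightarrow>
    ('w \<Rightarrow> real) \<Rightarrow> real \<Rightarrow> (real \<Rightarrow> 'h) \<Rightarrow> real \<Rightarrow> 'h"
  where "G_op M U a \<alpha> v t = (LINT \<tau>:{0<..<t}|lebesgue. P_op M U a \<alpha> (t - \<tau>) (v \<tau>))"

(* The mild solution of i D_t^alpha u + A u + F = 0, u(0) = x, where A is
   represented by (M, U, a). *)
definition mild_solution ::
  "'w measure \<Rightarrow> (('w \<Rightarrow> complex) \<Rightarrow> 'h::{complex_hilbert, second_countable_topology}) \<Rightarrow>
    ('w \<Rightarrow> real) \<Rightarrow> real \<Rightarrow> 'h \<Rightarrow> (real \<Rightarrow> 'h) \<Rightarrow> (real \<Rightarrow> 'h) \<Rightarrow> bool"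
  where "mild_solution M U a \<alpha> x F u \<longleftrightarrow>
    continuous_on {0..} u \<and>
    (\<forall>t\<ge>0. u t = S_op M U a \<alpha> t x + \<i> *\<^sub>C G_op M U a \<alpha> F t)"

definition Linf_pos :: "(real \<Rightarrow> 'h::{real_normed_vector, second_countable_topology}) set"
  where "Linf_pos = {F \<in> borel_measurable (lebesgue_on {0<..}).
    \<exists>C. AE \<tau> in lebesgue_on {0<..}. norm (F \<tau>) \<le> C}"

end

(* Write f(y) = E_{\<alpha>,\<alpha>}(iy) and g(y) = E_{\<alpha>,1}(iy) for real y.  With F_0 = A\<psi>, the Caputo equation for
   g(a t^\<alpha>) gives i G F_0 = S_t \<psi> - \<psi>, hence u(t) = S_t (x + \<psi>) - \<psi> + i G(F - F_0)(t).  So it suffices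
   that f is bounded (this controls the last term) and that g is bounded with g(y) -> 0 as |y| -> oo
   (then S_t -> 0 strongly by dominated convergence, as a is nonzero a.e.).

   Neither fact needs contour integrals.  The function k(t) = t^(\<alpha>-1) is annihilated by the
   Riemann-Liouville derivative and k(t) f(t^\<alpha>) is an eigenfunction for the eigenvalue i, so the
   Marchaud form of the derivative reads
     int_0^1 (1-s)^(-\<alpha>-1) s^(\<alpha>-1) (f(y) - f(y s^\<alpha>)) ds = c i y f(y)   with a real constant c.
   At a maximum of |f| on a segment [0,y] the left-hand side times cnj (f y) has nonnegative real part
   and the right-hand side has real part zero; this forces |f| <= f(0).  Moreover
     Gamma(1-\<alpha>) g(y) = int_0^1 (1-s)^(-\<alpha>) s^(\<alpha>-1) f(y s^\<alpha>) ds,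
   so g is bounded, and, f being proportional to g', an integration by parts away from s = 1 gives
   the decay as in the Riemann-Lebesgue lemma. *)

theory Submission
  imports Defs "HOL-Real_Asymp.Real_Asymp"
begin

section \<open>Mittag-Leffler series: convergence, continuity and derivative\<close>

text \<open>In Euler's integral only the part over \<open>[R, R+1]\<close> is kept, where the
  integrand is at least this constant. Since \<open>R\<close> is free, Gamma eventually dominates
  every geometric growth rate.\<close>

lemma Gamma_ge_powr:
  fixes x R :: real
  assumes "1 \<le> x" "0 < R"
  shows "exp (- (R + 1)) * R powr (x - 1) \<le> Gamma x"
proof -
  have I: "((\<lambda>t. t powr (x - 1) / exp t) has_integral Gamma x) {0..}"
    using Gamma_integral_real [of x] assms by simp
  have J: "((\<lambda>t. exp (- (R + 1)) * R powr (x - 1)) has_integral exp (- (R + 1)) * R powr (x - 1)) {R..R+1}"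
    using has_integral_const_real [of "exp (- (R + 1)) * R powr (x - 1)" R "R+1"] by simp
  have le: "exp (- (R + 1)) * R powr (x - 1) \<le> t powr (x - 1) / exp t" if "t \<in> {R..R+1}" for t
  proof -
    have "exp (- (R + 1)) * R powr (x - 1) \<le> exp (- t) * t powr (x - 1)"
      using that assms by (intro mult_mono powr_mono2) auto
    then show ?thesis by (simp add: exp_minus field_simps)
  qed
  show ?thesis
  proof (rule has_integral_le [OF _ I])
    show "((\<lambda>t. if t \<in> {R..R+1} then exp (- (R + 1)) * R powr (x - 1) else 0) has_integral
      exp (- (R + 1)) * R powr (x - 1)) {0..}"
      using J assms by (subst has_integral_restrict) auto
  qed (use le in auto)
qed

text \<open>Comparison with a geometric series: \<open>R\<close> is chosen with
  \<open>R powr \<alpha> = norm z + 1\<close>, so that, up to the constant \<open>C\<close>, Gamma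
  grows at least like \<open>(norm z + 1) ^ k\<close>, faster than the numerator.\<close>

lemma summable_mittag_leffler:
  fixes z :: complex
  assumes "0 < \<alpha>" "0 < \<beta>"
  shows "summable (\<lambda>k. norm (z ^ k / complex_of_real (Gamma (\<alpha> * real k + \<beta>))))"
proof -
  define R where "R = (norm z + 1) powr (1 / \<alpha>)"
  have z1: "norm z + 1 \<noteq> 0" using norm_ge_zero [of z] by linarith
  have R: "0 < R" unfolding R_def using z1 by simp
  have Ra: "R powr \<alpha> = norm z + 1"
    unfolding R_def using assms z1 by (simp add: powr_powr)
  define C where "C = exp (R + 1) * R powr (1 - \<beta>)"
  \<comment> \<open>From index \<open>N\<close> on the argument of Gamma is at least 1, as its lower
    bound requires.\<close>
  obtain N :: nat where N: "1 / \<alpha> < real N" using reals_Archimedean2 by blast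
  show ?thesis
  proof (rule summable_comparison_test')
    show "summable (\<lambda>k. C * (norm z / (norm z + 1)) ^ k)"
      by (intro summable_mult summable_geometric) (simp add: add_nonneg_pos)
    fix k assume "N \<le> k"
    then have "1 / \<alpha> \<le> real k" using N by simp
    then have k: "1 \<le> \<alpha> * real k" using assms by (simp add: field_simps)
    have G: "exp (- (R + 1)) * R powr (\<alpha> * real k + \<beta> - 1) \<le> Gamma (\<alpha> * real k + \<beta>)"
      using k assms R by (intro Gamma_ge_powr) auto
    have "R powr (\<alpha> * real k + \<beta> - 1) = R powr (\<beta> - 1) * (R powr \<alpha>) ^ k"
      using R by (simp add: powr_powr powr_realpow [symmetric] powr_add [symmetric] algebra_simps)
    then have e: "exp (- (R + 1)) * R powr (\<alpha> * real k + \<beta> - 1) = (norm z + 1) ^ k / C"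
    proof -
      have "exp (- (R + 1)) = 1 / exp (R + 1)" "R powr (1 - \<beta>) = 1 / R powr (\<beta> - 1)"
        using R by (simp_all only: exp_minus powr_minus [symmetric] inverse_eq_divide [symmetric]) simp
      then show ?thesis using R \<open>R powr (\<alpha> * real k + \<beta> - 1) = _\<close> unfolding C_def Ra by simp
    qed
    have C: "0 < C" using R unfolding C_def by simp
    have p: "0 < (norm z + 1) ^ k / C" using C by (simp add: add_nonneg_pos)
    then have Gp: "0 < Gamma (\<alpha> * real k + \<beta>)" using G e by linarith
    have "norm z ^ k / Gamma (\<alpha> * real k + \<beta>) \<le> norm z ^ k / ((norm z + 1) ^ k / C)"
      using G e p by (intro divide_left_mono mult_pos_pos [OF Gp p]) auto
    then show "norm (norm (z ^ k / complex_of_real (Gamma (\<alpha> * real k + \<beta>)))) \<le> C * (norm z / (norm z + 1)) ^ k"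
      using Gp by (simp add: norm_divide norm_power power_divide field_simps)
  qed
qed

lemma sums_mittag_leffler:
  assumes "0 < \<alpha>" "0 < \<beta>"
  shows "(\<lambda>k. z ^ k / complex_of_real (Gamma (\<alpha> * real k + \<beta>))) sums mittag_leffler \<alpha> \<beta> z"
  unfolding mittag_leffler_def
  by (rule summable_sums, rule summable_norm_cancel, rule summable_mittag_leffler [OF assms])

lemma mittag_leffler_0: "mittag_leffler \<alpha> \<beta> 0 = complex_of_real (1 / Gamma \<beta>)"
  unfolding mittag_leffler_def
  using powser_zero [of "\<lambda>k. 1 / complex_of_real (Gamma (\<alpha> * real k + \<beta>))"] by simp

lemma isCont_mittag_leffler:
  assumes "0 < \<alpha>" "0 < \<beta>"
  shows "isCont (mittag_leffler \<alpha> \<beta>) z"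
proof -
  have "isCont (\<lambda>z. \<Sum>k. 1 / complex_of_real (Gamma (\<alpha> * real k + \<beta>)) * z ^ k) z"
    by (rule isCont_powser_converges_everywhere)
      (use sums_mittag_leffler [OF assms] in \<open>auto simp: sums_iff\<close>)
  then show ?thesis by (simp add: mittag_leffler_def [abs_def])
qed

text \<open>Termwise differentiation: by the functional equation of Gamma the factor
  \<open>Suc k\<close> cancels against \<open>Gamma (\<alpha> * Suc k + 1)\<close>, which leaves
  \<open>1 / \<alpha>\<close> and turns the second parameter into \<open>\<alpha>\<close>.\<close>

lemma has_field_derivative_mittag_leffler_1:
  assumes "0 < \<alpha>"
  shows "(mittag_leffler \<alpha> 1 has_field_derivative mittag_leffler \<alpha> \<alpha> z / of_real \<alpha>) (at z)"
proof -
  define c where "c = (\<lambda>k. 1 / complex_of_real (Gamma (\<alpha> * real k + 1)))"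
  have eq: "diffs c k = (1 / complex_of_real (Gamma (\<alpha> * real k + \<alpha>))) / of_real \<alpha>" for k
  proof -
    have p: "0 < \<alpha> * real (Suc k)" using assms by simp
    have e: "\<alpha> * real k + \<alpha> = \<alpha> * real (Suc k)" by (simp add: algebra_simps)
    have "Gamma (\<alpha> * real (Suc k) + 1) = (\<alpha> * real (Suc k)) * Gamma (\<alpha> * real (Suc k))"
      using p by (intro Gamma_plus1) auto
    then have "real (Suc k) / Gamma (\<alpha> * real (Suc k) + 1) = 1 / Gamma (\<alpha> * real k + \<alpha>) / \<alpha>"
      using assms unfolding e by (simp del: of_nat_Suc)
    from arg_cong [OF this, of complex_of_real] show ?thesis
      unfolding diffs_def c_def by simp
  qed
  have "((\<lambda>z. \<Sum>k. c k * z ^ k) has_field_derivative (\<Sum>k. diffs c k * z ^ k)) (at z)"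
    by (rule termdiffs_strong_converges_everywhere)
      (use sums_mittag_leffler [of \<alpha> 1] assms in \<open>auto simp: sums_iff c_def\<close>)
  moreover have "(\<Sum>k. diffs c k * z ^ k) = mittag_leffler \<alpha> \<alpha> z / of_real \<alpha>"
    using sums_divide [OF sums_mittag_leffler [of \<alpha> \<alpha> z], of "of_real \<alpha>"] assms
    by (simp add: eq sums_iff)
  ultimately show ?thesis by (simp add: mittag_leffler_def [abs_def] c_def)
qed

section \<open>Marchaud identity and maximum principle on the imaginary axis\<close>

text \<open>With \<open>c = \<alpha> * k\<close> this is the difference integral of the Marchaud
  form for the k-th term of the series. The weight alone is not integrable at 1; the factor
  \<open>1 - s powr c\<close> vanishes there to first order.\<close>

lemma has_integral_Marchaud_kernel:
  fixes \<alpha> c :: real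
  assumes "0 < \<alpha>" "\<alpha> < 1" "0 < c"
  shows "((\<lambda>s. (1 - s) powr (- \<alpha> - 1) * s powr (\<alpha> - 1) * (1 - s powr c)) has_integral
    Gamma (1 - \<alpha>) / \<alpha> * (Gamma (\<alpha> + c) / Gamma c)) {0..1}"
proof -
  \<comment> \<open>Integration by parts: \<open>(s / (1 - s)) powr \<alpha> / \<alpha>\<close> is a primitive of \<open>(1 - s) powr (- \<alpha> - 1) * s powr (\<alpha> - 1)\<close>.\<close>
  define H where "H = (\<lambda>s::real. s powr \<alpha> * (1 - s) powr (- \<alpha>) * (1 - s powr c) / \<alpha>)"
  define h where "h = (\<lambda>s::real. (1 - s) powr (- \<alpha> - 1) * s powr (\<alpha> - 1) * (1 - s powr c))"
  define b where "b = (\<lambda>s::real. s powr (\<alpha> + c - 1) * (1 - s) powr (1 - \<alpha> - 1))"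
  \<comment> \<open>At 1 the first-order zero of \<open>1 - s powr c\<close> beats
    \<open>(1 - s) powr (- \<alpha>)\<close> because \<open>\<alpha> < 1\<close>, so no boundary
    term survives.\<close>
  have lim1: "((\<lambda>s. s powr \<alpha> * (1 - s) powr (- \<alpha>) * (1 - s powr c) / \<alpha>) \<longlongrightarrow> 0) (at_left 1)"
    using assms by real_asymp
  have lim0: "((\<lambda>s. s powr \<alpha> * (1 - s) powr (- \<alpha>) * (1 - s powr c) / \<alpha>) \<longlongrightarrow> 0) (at_right 0)"
    using assms by real_asymp
  \<comment> \<open>Since \<open>0 powr b = 0\<close> for every \<open>b\<close>, the literal values
    of \<open>H\<close> at both ends are 0 and agree with the limits.\<close>
  have "continuous_on {0..1} H"
  proof (rule continuous_on_IccI)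
    show "(H \<longlongrightarrow> H 0) (at_right 0)" using lim0 by (simp add: H_def)
    show "(H \<longlongrightarrow> H 1) (at_left 1)" using lim1 by (simp add: H_def)
    fix s :: real assume "0 < s" "s < 1"
    then show "H \<midarrow>s\<rightarrow> H s" unfolding H_def using assms by (auto intro!: tendsto_intros)
  qed simp
  moreover have "(H has_vector_derivative (h s - c / \<alpha> * b s)) (at s)" if "s \<in> {0<..<1}" for s
  proof -
    have 1: "(H has_real_derivative
       (\<alpha> * s powr (\<alpha> - 1) * (1 - s) powr (- \<alpha>) * (1 - s powr c)
         + s powr \<alpha> * (\<alpha> * (1 - s) powr (- \<alpha> - 1)) * (1 - s powr c)
         - s powr \<alpha> * (1 - s) powr (- \<alpha>) * (c * s powr (c - 1))) / \<alpha>) (at s)"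
      unfolding H_def using that assms
      by (auto intro!: derivative_eq_intros simp: field_simps)
    \<comment> \<open>After the common powers are taken out, this is
      \<open>(1 - s) + s = 1\<close>.\<close>
    have 2: "s powr (\<alpha> - 1) * (1 - s) powr (- \<alpha>) + s powr \<alpha> * (1 - s) powr (- \<alpha> - 1)
       = s powr (\<alpha> - 1) * (1 - s) powr (- \<alpha> - 1)"
    proof -
      have "s powr \<alpha> = s powr (\<alpha> - 1) * s" "(1 - s) powr (- \<alpha>) = (1 - s) powr (- \<alpha> - 1) * (1 - s)"
        using that by (simp_all add: powr_diff)
      moreover have "X * (Y * (1 - s)) + X * s * Y = X * Y" for X Y by (simp add: algebra_simps)
      ultimately show ?thesis by (simp only:)
    qed
    have 3: "s powr \<alpha> * s powr (c - 1) = s powr (\<alpha> + c - 1)"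
      by (simp add: powr_add [symmetric] algebra_simps)
    have "(\<alpha> * s powr (\<alpha> - 1) * (1 - s) powr (- \<alpha>) * (1 - s powr c)
         + s powr \<alpha> * (\<alpha> * (1 - s) powr (- \<alpha> - 1)) * (1 - s powr c)
         - s powr \<alpha> * (1 - s) powr (- \<alpha>) * (c * s powr (c - 1))) / \<alpha>
        = (s powr (\<alpha> - 1) * (1 - s) powr (- \<alpha>) + s powr \<alpha> * (1 - s) powr (- \<alpha> - 1)) * (1 - s powr c)
          - c / \<alpha> * ((s powr \<alpha> * s powr (c - 1)) * (1 - s) powr (- \<alpha>))"
      using assms by (simp add: field_simps)
    also have "\<dots> = h s - c / \<alpha> * b s"
      unfolding 2 3 h_def b_def by simp
    finally have "(H has_real_derivative (h s - c / \<alpha> * b s)) (at s)" using 1 by simp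
    then show ?thesis by (simp add: has_real_derivative_iff_has_vector_derivative)
  qed
  ultimately have "((\<lambda>s. h s - c / \<alpha> * b s) has_integral (H 1 - H 0)) {0..1}"
    by (intro fundamental_theorem_of_calculus_interior) auto
  then have 1: "((\<lambda>s. h s - c / \<alpha> * b s) has_integral 0) {0..1}"
    by (simp add: H_def)
  have "(b has_integral Beta (\<alpha> + c) (1 - \<alpha>)) {0..1}"
    unfolding b_def using assms by (intro has_integral_Beta_real) auto
  from has_integral_add [OF 1 has_integral_mult_right [OF this, of "c / \<alpha>"]]
  have "(h has_integral c / \<alpha> * Beta (\<alpha> + c) (1 - \<alpha>)) {0..1}" by simp
  moreover have "c / \<alpha> * Beta (\<alpha> + c) (1 - \<alpha>) = Gamma (1 - \<alpha>) / \<alpha> * (Gamma (\<alpha> + c) / Gamma c)"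
  proof -
    have "Gamma (c + 1) = c * Gamma c" using assms by (intro Gamma_plus1) auto
    then show ?thesis using assms by (simp add: Beta_def add_ac)
  qed
  ultimately show ?thesis by (simp add: h_def)
qed

text \<open>As \<open>K k\<close> is nonnegative, the L1 norm of the k-th term is exactly
  \<open>norm (c k) * J k\<close>; summability of these norms lets sum and Lebesgue integral be
  exchanged. The result is carried back to the gauge integral, in which the kernel integrals are
  known.\<close>

lemma has_integral_suminf_absolutely:
  fixes c :: "nat \<Rightarrow> complex" and K :: "nat \<Rightarrow> real \<Rightarrow> real"
  assumes K: "\<And>k. (K k has_integral J k) {0..1}"
    and nonneg: "\<And>k s. s \<in> {0..1} \<Longrightarrow> 0 \<le> K k s"
    and J: "summable (\<lambda>k. norm (c k) * J k)"
    and sm: "\<And>s. s \<in> {0..1} \<Longrightarrow> summable (\<lambda>k. norm (c k) * K k s)"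
  shows "((\<lambda>s. \<Sum>k. c k * of_real (K k s)) has_integral (\<Sum>k. c k * of_real (J k))) {0..1}"
proof -
  let ?g = "\<lambda>k s. indicator {0..1} s *\<^sub>R (c k * complex_of_real (K k s))"
  have aK: "K k absolutely_integrable_on {0..1}" for k
    using K nonneg by (intro nonnegative_absolutely_integrable_1) auto
  have iK: "(LINT s:{0..1}|lebesgue. K k s) = J k" for k
    using set_lebesgue_integral_eq_integral(2) [OF aK] K by (simp add: integral_unique)
  have i: "integrable lebesgue (?g k)" for k
  proof -
    have "integrable lebesgue (\<lambda>s. c k * complex_of_real (indicator {0..1} s *\<^sub>R K k s))"
      using aK [of k] unfolding set_integrable_def by (intro integrable_mult_right integrable_of_real)
    then show ?thesis by (simp add: scaleR_conv_of_real mult_ac)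
  qed
  have v: "(LINT s|lebesgue. ?g k s) = c k * of_real (J k)" for k
  proof -
    have "(LINT s|lebesgue. ?g k s) = (LINT s|lebesgue. c k * complex_of_real (indicator {0..1} s *\<^sub>R K k s))"
      by (intro Bochner_Integration.integral_cong) (auto simp: indicator_def)
    also have "\<dots> = c k * complex_of_real (LINT s:{0..1}|lebesgue. K k s)"
      unfolding set_lebesgue_integral_def by (simp del: of_real_mult)
    finally show ?thesis by (simp only: iK)
  qed
  have n: "(LINT s|lebesgue. norm (?g k s)) = norm (c k) * J k" for k
  proof -
    have "(LINT s|lebesgue. norm (?g k s)) = (LINT s|lebesgue. norm (c k) * (indicator {0..1} s *\<^sub>R K k s))"
      using nonneg by (intro Bochner_Integration.integral_cong) (auto simp: indicator_def norm_mult)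
    also have "\<dots> = norm (c k) * (LINT s:{0..1}|lebesgue. K k s)"
      unfolding set_lebesgue_integral_def by simp
    finally show ?thesis by (simp only: iK)
  qed
  have s: "summable (\<lambda>k. norm (?g k s))" for s
    using sm [of s] nonneg [of s] by (cases "s \<in> {0..1}") (auto simp: norm_mult)
  have s': "summable (\<lambda>k. LINT s|lebesgue. norm (?g k s))"
    unfolding n by (rule J)
  have sums: "integrable lebesgue (\<lambda>s. \<Sum>k. ?g k s)"
    "(LINT s|lebesgue. (\<Sum>k. ?g k s)) = (\<Sum>k. LINT s|lebesgue. ?g k s)"
    using i s s' by (auto intro!: integrable_suminf integral_suminf)
  have e: "(\<Sum>k. ?g k s) = indicator {0..1} s *\<^sub>R (\<Sum>k. c k * complex_of_real (K k s))" for s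
    by (cases "s \<in> {0..1}") auto
  have "(\<lambda>s. \<Sum>k. c k * of_real (K k s)) absolutely_integrable_on {0..1}"
    using sums(1) unfolding e set_integrable_def .
  from set_lebesgue_integral_eq_integral [OF this] sums(2)
  show ?thesis unfolding e v set_lebesgue_integral_def by (simp add: has_integral_iff)
qed

text \<open>By contradiction: if the maximum exceeded the value at 0, the difference integral,
  paired with the maximal value, would have strictly positive real part, while the imaginary
  eigenvalue makes that real part 0.\<close>

lemma norm_mittag_leffler_imag_le:
  fixes y :: real
  assumes "0 < \<alpha>" "\<alpha> < 1"
  shows "norm (mittag_leffler \<alpha> \<alpha> (\<i> * of_real y)) \<le> 1 / Gamma \<alpha>"
proof (rule ccontr)
  define f where "f = (\<lambda>y. mittag_leffler \<alpha> \<alpha> (\<i> * of_real y))"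
  define w where "w = (\<lambda>s::real. (1 - s) powr (- \<alpha> - 1) * s powr (\<alpha> - 1))"
  have cont: "isCont f x" for x
    unfolding f_def by (intro isCont_o2 [OF _ isCont_mittag_leffler] continuous_intros) (use assms in auto)
  have f0: "norm (f 0) = 1 / Gamma \<alpha>"
    using assms by (simp add: f_def mittag_leffler_0 norm_divide)
  assume "\<not> norm (mittag_leffler \<alpha> \<alpha> (\<i> * of_real y)) \<le> 1 / Gamma \<alpha>"
  then have fy: "norm (f 0) < norm (f y)" unfolding f0 by (simp add: f_def)
  have "continuous_on {0..1} (\<lambda>r. norm (f (y * r)))"
    by (intro continuous_at_imp_continuous_on ballI continuous_intros isCont_o2 [OF _ cont])
  \<comment> \<open>The parameter \<open>r\<close> runs along the segment from 0 to
    \<open>y\<close>, whatever the sign of \<open>y\<close>; the rescaled points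
    \<open>r0 * s powr \<alpha>\<close> stay in its range.\<close>
  then obtain r0 where r0: "r0 \<in> {0..1}" and max: "\<And>r. r \<in> {0..1} \<Longrightarrow> norm (f (y * r)) \<le> norm (f (y * r0))"
    using continuous_attains_sup [of "{0..1::real}" "\<lambda>r. norm (f (y * r))"] by auto
  define m where "m = f (y * r0)"
  have m: "norm (f 0) < norm m" using fy max [of 1] by (simp add: m_def)
  have le: "norm (f (y * r0 * s powr \<alpha>)) \<le> norm m" if "s \<in> {0..1}" for s
  proof -
    have "s powr \<alpha> \<le> 1" using that assms by (simp add: powr_le1)
    then have "r0 * s powr \<alpha> \<in> {0..1}" using r0 by (auto intro: mult_le_one)
    from max [OF this] show ?thesis by (simp add: m_def mult.assoc)
  qed
  define z where "z = \<i> * complex_of_real (y * r0)"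
  define c where "c = (\<lambda>k. z ^ k / complex_of_real (Gamma (\<alpha> * real k + \<alpha>)))"
  define K where "K = (\<lambda>k s. w s * (1 - s powr (\<alpha> * real k)))"
  define J where "J = (\<lambda>k. Gamma (1 - \<alpha>) / \<alpha> * (Gamma (\<alpha> + \<alpha> * real k) / Gamma (\<alpha> * real k)))"
  have G1: "0 < Gamma (1 - \<alpha>)" using assms by simp
  have Gk: "0 < Gamma (\<alpha> * real k + \<alpha>)" for k using assms by (simp add: add_nonneg_pos)
  have sc: "summable (\<lambda>k. norm (c k))"
    unfolding c_def using summable_mittag_leffler assms by blast
  have KJ: "(K k has_integral J k) {0..1}" for k
  proof (cases "k = 0")
    case True
    \<comment> \<open>For \<open>k = 0\<close> both sides are 0: \<open>1 - s powr 0\<close>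
      vanishes off \<open>s = 0\<close>, and \<open>Gamma 0 = 0\<close> makes the quotient in
      \<open>J 0\<close> zero.\<close>
    have "K 0 s = (if s \<in> {0} then w 0 else 0)" if "s \<in> {0..1}" for s using that by (simp add: K_def)
    then have "(K 0 has_integral 0) {0..1}"
      using has_integral_is_0 by (intro has_integral_spike_finite [of "{0}" "{0..1}" "K 0" "\<lambda>_. 0" 0]) auto
    then show ?thesis using True by (simp add: J_def)
  next
    case False
    then show ?thesis
      using has_integral_Marchaud_kernel [of \<alpha> "\<alpha> * real k"] assms
      by (simp add: K_def J_def w_def [abs_def])
  qed
  have K0: "0 \<le> K k s" if "s \<in> {0..1}" for k s
    using that assms by (auto simp: K_def w_def intro!: mult_nonneg_nonneg powr_le1)
  \<comment> \<open>The quotient in \<open>J k\<close> replaces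
    \<open>Gamma (\<alpha> * k + \<alpha>)\<close> by \<open>Gamma (\<alpha> * k)\<close>: the same
    series shifted by one index, hence multiplied by \<open>z\<close>.\<close>
  have cJ: "c k * of_real (J k) = of_real (Gamma (1 - \<alpha>) / \<alpha>) * (z ^ k / of_real (Gamma (\<alpha> * real k)))" for k
    using Gk [of k] by (simp add: c_def J_def add.commute field_simps)
  have tail: "(\<lambda>k. z ^ Suc k / complex_of_real (Gamma (\<alpha> * real (Suc k)))) sums (z * m)"
    using sums_mult [OF sums_mittag_leffler [of \<alpha> \<alpha> z], of z] assms
    by (simp add: m_def f_def z_def algebra_simps)
  \<comment> \<open>The additional term at \<open>k = 0\<close> is \<open>1 / Gamma 0\<close>, which
    is 0.\<close>
  have sz: "(\<lambda>k. z ^ k / complex_of_real (Gamma (\<alpha> * real k))) sums (z * m)"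
    using sums_Suc [OF tail] by simp
  have zn: "summable (\<lambda>k. norm (z ^ k / complex_of_real (Gamma (\<alpha> * real k))))"
  proof -
    have "summable (\<lambda>k. norm z * norm (z ^ k / complex_of_real (Gamma (\<alpha> * real k + \<alpha>))))"
      using summable_mittag_leffler assms by (intro summable_mult) blast
    then have "summable (\<lambda>k. norm (z ^ Suc k / complex_of_real (Gamma (\<alpha> * real (Suc k)))))"
      by (simp add: norm_mult norm_divide algebra_simps)
    then show ?thesis by (subst (asm) summable_Suc_iff)
  qed
  have sJ: "summable (\<lambda>k. norm (c k) * J k)"
  proof -
    have "norm (c k) * J k = Gamma (1 - \<alpha>) / \<alpha> * norm (z ^ k / complex_of_real (Gamma (\<alpha> * real k)))" for k
    proof -
      have "0 \<le> J k" using has_integral_nonneg [OF KJ K0] by auto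
      then have "norm (c k) * J k = norm (c k * of_real (J k))" by (simp add: norm_mult)
      then show ?thesis using G1 assms by (simp only: cJ) (simp add: norm_mult norm_divide)
    qed
    then show ?thesis using summable_mult [OF zn, of "Gamma (1 - \<alpha>) / \<alpha>"] by simp
  qed
  have sK: "summable (\<lambda>k. norm (c k) * K k s)" if "s \<in> {0..1}" for s
  proof (rule summable_comparison_test')
    show "summable (\<lambda>k. norm (c k) * w s)" using sc by (rule summable_mult2)
    fix k
    have "0 \<le> w s" using that by (simp add: w_def)
    then have "K k s \<le> w s" using that by (simp add: K_def mult_left_le)
    then show "norm (norm (c k) * K k s) \<le> norm (c k) * w s"
      using K0 [OF that, of k] by (simp add: mult_left_mono)
  qed
  have sumK: "(\<Sum>k. c k * of_real (K k s)) = of_real (w s) * (m - f (y * r0 * s powr \<alpha>))" if "s \<in> {0..1}" for s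
  proof (cases "s = 0")
    case True
    then show ?thesis using assms by (simp add: K_def w_def)
  next
    case False
    have 1: "c sums m"
      using sums_mittag_leffler [of \<alpha> \<alpha> z] assms by (simp add: c_def [abs_def] m_def f_def z_def)
    have "(\<lambda>k. (\<i> * of_real (y * r0 * s powr \<alpha>)) ^ k / complex_of_real (Gamma (\<alpha> * real k + \<alpha>)))
        sums f (y * r0 * s powr \<alpha>)"
      unfolding f_def using assms by (intro sums_mittag_leffler)
    moreover have "(\<i> * of_real (y * r0 * s powr \<alpha>)) ^ k / complex_of_real (Gamma (\<alpha> * real k + \<alpha>))
        = c k * of_real (s powr (\<alpha> * real k))" for k
    proof -
      have "s powr (\<alpha> * real k) = (s powr \<alpha>) ^ k"
        using False that by (simp add: powr_powr powr_realpow [symmetric])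
      then show ?thesis by (simp add: c_def z_def power_mult_distrib)
    qed
    ultimately have 2: "(\<lambda>k. c k * of_real (s powr (\<alpha> * real k))) sums f (y * r0 * s powr \<alpha>)" by simp
    show ?thesis
      using sums_mult [OF sums_diff [OF 1 2], of "of_real (w s)"]
      by (simp add: sums_iff K_def algebra_simps)
  qed
  \<comment> \<open>The eigenvalue relation at the maximum point: the difference integral is a real
    constant times \<open>z * m\<close>.\<close>
  have I: "((\<lambda>s. of_real (w s) * (m - f (y * r0 * s powr \<alpha>))) has_integral of_real (Gamma (1 - \<alpha>) / \<alpha>) * (z * m)) {0..1}"
  proof -
    have "(\<Sum>k. c k * of_real (J k)) = of_real (Gamma (1 - \<alpha>) / \<alpha>) * (z * m)"
      unfolding cJ by (rule sums_unique [symmetric, OF sums_mult [OF sz]])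
    with has_integral_suminf_absolutely [OF KJ K0 sJ sK]
    have "((\<lambda>s. \<Sum>k. c k * of_real (K k s)) has_integral of_real (Gamma (1 - \<alpha>) / \<alpha>) * (z * m)) {0..1}"
      by simp
    then show ?thesis by (rule has_integral_eq [rotated]) (rule sumK)
  qed
  \<comment> \<open>Multiplication by \<open>cnj m\<close> turns the right-hand side into a real
    multiple of \<open>z\<close>, which is imaginary, so its real part is 0.\<close>
  have "((\<lambda>s. Re (cnj m * (of_real (w s) * (m - f (y * r0 * s powr \<alpha>))))) has_integral
     Re (cnj m * (of_real (Gamma (1 - \<alpha>) / \<alpha>) * (z * m)))) {0..1}"
    using has_integral_linear [OF has_integral_mult_right [OF I, of "cnj m"] bounded_linear_Re] by (simp add: o_def)
  moreover have "Re (cnj m * (of_real (Gamma (1 - \<alpha>) / \<alpha>) * (z * m))) = 0"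
    by (simp add: z_def algebra_simps)
  moreover have eq: "Re (cnj m * (of_real (w s) * (m - v))) = w s * Re (cnj m * (m - v))" for s v
    by (simp add: algebra_simps)
  ultimately have R: "((\<lambda>s. w s * Re (cnj m * (m - f (y * r0 * s powr \<alpha>)))) has_integral 0) {0..1}"
    by (simp only: eq)
  \<comment> \<open>Applied with \<open>norm v \<le> norm m\<close>, this makes the integrand in
    \<open>R\<close> nonnegative on all of \<open>[0, 1]\<close>.\<close>
  have lower: "norm m * (norm m - norm v) \<le> Re (cnj m * (m - v))" for v
  proof -
    have "Re (cnj m * v) \<le> norm m * norm v"
      using complex_Re_le_cmod [of "cnj m * v"] by (simp add: norm_mult)
    moreover have "Re (cnj m * m) = norm m * norm m"
      by (metis complex_mod_cnj complex_norm_square mult.commute Re_complex_of_real power2_eq_square)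
    ultimately show ?thesis by (simp add: algebra_simps)
  qed
  \<comment> \<open>Half the gap between the maximum and the value at 0; by continuity the norm of
    \<open>f\<close> stays below \<open>norm m - e\<close> near 0.\<close>
  define e where "e = (norm m - norm (f 0)) / 2"
  have e: "0 < e" using m by (simp add: e_def)
  have "isCont (\<lambda>v. f (y * r0 * v)) 0"
    by (intro isCont_o2 [OF _ cont] continuous_intros)
  then have "((\<lambda>v. norm (f (y * r0 * v))) \<longlongrightarrow> norm (f (y * r0 * 0))) (at 0)"
    by (intro tendsto_norm) (simp add: isCont_def)
  then have "\<forall>\<^sub>F v in at 0. norm (f (y * r0 * v)) < norm m - e"
    using m by (intro order_tendstoD) (auto simp: e_def field_simps)
  then obtain d where d: "0 < d" "\<And>v. v \<noteq> 0 \<Longrightarrow> \<bar>v\<bar> < d \<Longrightarrow> norm (f (y * r0 * v)) < norm m - e"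
    unfolding eventually_at by (auto simp: dist_real_def)
  \<comment> \<open>For \<open>0 < s \<le> s1\<close> the point \<open>s powr \<alpha>\<close> lies
    in the range \<open>d\<close> of this gap, so the whole interval \<open>{s1/2..s1}\<close>
    contributes a positive amount to the integral.\<close>
  define s1 where "s1 = min (1/2) ((d / 2) powr (1 / \<alpha>))"
  have s1: "0 < s1" "s1 < 1" using d by (auto simp: s1_def min_def)
  have small: "e * norm m \<le> w s * Re (cnj m * (m - f (y * r0 * s powr \<alpha>)))" if s: "s \<in> {s1/2..s1}" for s
  proof -
    have s01: "0 < s" "s < 1" using s s1 by auto
    have "s powr \<alpha> \<le> ((d / 2) powr (1 / \<alpha>)) powr \<alpha>"
      using s s01 assms by (intro powr_mono2) (auto simp: s1_def)
    also have "\<dots> = d / 2" using assms d by (simp add: powr_powr)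
    finally have "s powr \<alpha> < d" using d by simp
    then have "norm (f (y * r0 * s powr \<alpha>)) < norm m - e" using d(2) [of "s powr \<alpha>"] s01 by simp
    then have "norm m * e \<le> norm m * (norm m - norm (f (y * r0 * s powr \<alpha>)))"
      by (intro mult_left_mono) auto
    also note lower
    finally have 1: "norm m * e \<le> Re (cnj m * (m - f (y * r0 * s powr \<alpha>)))" .
    have "1 \<le> (1 - s) powr (- \<alpha> - 1)" "1 \<le> s powr (\<alpha> - 1)"
      using s01 assms powr_mono2' [of "- \<alpha> - 1" "1 - s" 1] powr_mono2' [of "\<alpha> - 1" s 1] by auto
    then have "1 \<le> w s" unfolding w_def using mult_mono [of 1 "(1 - s) powr (- \<alpha> - 1)" 1 "s powr (\<alpha> - 1)"] by simp
    then have "1 * (norm m * e) \<le> w s * Re (cnj m * (m - f (y * r0 * s powr \<alpha>)))"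
      using 1 e by (intro mult_mono) auto
    then show ?thesis by (simp add: mult.commute)
  qed
  have "s1 / 2 * (e * norm m) \<le> 0"
  proof (rule has_integral_le [OF _ R])
    have "((\<lambda>s. e * norm m) has_integral s1 / 2 * (e * norm m)) {s1/2..s1}"
      using has_integral_const_real [of "e * norm m" "s1/2" s1] s1 by simp
    then show "((\<lambda>s. if s \<in> {s1/2..s1} then e * norm m else 0) has_integral s1 / 2 * (e * norm m)) {0..1}"
      using s1 by (subst has_integral_restrict) auto
    fix s :: real assume s: "s \<in> {0..1}"
    have "0 \<le> norm m * (norm m - norm (f (y * r0 * s powr \<alpha>)))"
      using le [OF s] by simp
    also note lower
    finally have "0 \<le> w s * Re (cnj m * (m - f (y * r0 * s powr \<alpha>)))"
      using s by (simp add: w_def)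
    then show "(if s \<in> {s1/2..s1} then e * norm m else 0) \<le> w s * Re (cnj m * (m - f (y * r0 * s powr \<alpha>)))"
      using small by simp
  qed
  moreover have "0 < norm m" using m norm_ge_zero [of "f 0"] by linarith
  then have "0 < s1 / 2 * (e * norm m)" using s1 e by simp
  ultimately show False by linarith
qed

section \<open>The function \<open>mittag_leffler \<alpha> 1\<close> on the imaginary axis: bound
  and decay\<close>

text \<open>Termwise Beta integrals: each one cancels \<open>Gamma (\<alpha> * k + \<alpha>)\<close>
  and puts \<open>Gamma (\<alpha> * k + 1)\<close> in its place. Up to the factor
  \<open>Gamma (1 - \<alpha>)\<close> this is the Riemann-Liouville integral of order
  \<open>1 - \<alpha>\<close>, taken at time 1.\<close>

lemma mittag_leffler_1_has_integral:
  fixes y :: real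
  assumes "0 < \<alpha>" "\<alpha> < 1"
  shows "((\<lambda>s. of_real ((1 - s) powr (- \<alpha>) * s powr (\<alpha> - 1)) *
      mittag_leffler \<alpha> \<alpha> (\<i> * of_real (y * s powr \<alpha>))) has_integral
    of_real (Gamma (1 - \<alpha>)) * mittag_leffler \<alpha> 1 (\<i> * of_real y)) {0..1}"
proof -
  define z where "z = \<i> * complex_of_real y"
  define c where "c = (\<lambda>k. z ^ k / complex_of_real (Gamma (\<alpha> * real k + \<alpha>)))"
  define w where "w = (\<lambda>s::real. (1 - s) powr (- \<alpha>) * s powr (\<alpha> - 1))"
  define K where "K = (\<lambda>k s::real. s powr (\<alpha> * real k + \<alpha> - 1) * (1 - s) powr (1 - \<alpha> - 1))"
  define J where "J = (\<lambda>k. Beta (\<alpha> * real k + \<alpha>) (1 - \<alpha>))"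
  have Gk: "0 < Gamma (\<alpha> * real k + \<alpha>)" "0 < Gamma (\<alpha> * real k + 1)" for k
    using assms by (simp_all add: add_nonneg_pos)
  have KJ: "(K k has_integral J k) {0..1}" for k
    unfolding K_def J_def using assms by (intro has_integral_Beta_real) (auto simp: add_nonneg_pos)
  have K0: "0 \<le> K k s" for k s by (simp add: K_def)
  have Jk: "J k = Gamma (\<alpha> * real k + \<alpha>) * Gamma (1 - \<alpha>) / Gamma (\<alpha> * real k + 1)" for k
    by (simp add: J_def Beta_def)
  have cJ: "c k * of_real (J k) = of_real (Gamma (1 - \<alpha>)) * (z ^ k / complex_of_real (Gamma (\<alpha> * real k + 1)))" for k
    using Gk [of k] by (simp add: c_def Jk)
  have Kw: "K k s = w s * (s powr \<alpha>) ^ k" if "s \<in> {0..1}" for k s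
  proof (cases "s = 0")
    case False
    then have "s powr (\<alpha> * real k + \<alpha> - 1) = s powr (\<alpha> - 1) * (s powr \<alpha>) ^ k"
      using that by (simp add: powr_powr powr_realpow [symmetric] powr_add [symmetric] algebra_simps)
    then show ?thesis by (simp add: K_def w_def)
  qed (simp add: K_def w_def)
  have sJ: "summable (\<lambda>k. norm (c k) * J k)"
  proof -
    have "norm (c k) * J k = norm (c k * of_real (J k))" for k
      using has_integral_nonneg [OF KJ K0] by (simp add: norm_mult)
    moreover have "summable (\<lambda>k. norm (c k * of_real (J k)))"
      unfolding cJ norm_mult using assms by (intro summable_mult summable_mittag_leffler) auto
    ultimately show ?thesis by simp
  qed
  have ws: "(\<lambda>k. c k * of_real (K k s)) sums (of_real (w s) * mittag_leffler \<alpha> \<alpha> (\<i> * of_real (y * s powr \<alpha>)))"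
    and sK: "summable (\<lambda>k. norm (c k) * K k s)"
    if s: "s \<in> {0..1}" for s
  proof -
    let ?t = "\<lambda>k. (\<i> * of_real (y * s powr \<alpha>)) ^ k / complex_of_real (Gamma (\<alpha> * real k + \<alpha>))"
    have t: "c k * of_real (K k s) = of_real (w s) * ?t k" for k
      by (simp add: c_def Kw [OF s] z_def power_mult_distrib)
    show "(\<lambda>k. c k * of_real (K k s)) sums (of_real (w s) * mittag_leffler \<alpha> \<alpha> (\<i> * of_real (y * s powr \<alpha>)))"
      unfolding t using assms by (intro sums_mult sums_mittag_leffler)
    have "norm (c k) * K k s = norm (c k * of_real (K k s))" for k
      using K0 by (simp add: norm_mult)
    moreover have "summable (\<lambda>k. norm (c k * of_real (K k s)))"
      unfolding t norm_mult using assms by (intro summable_mult summable_mittag_leffler)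
    ultimately show "summable (\<lambda>k. norm (c k) * K k s)" by simp
  qed
  have "(\<Sum>k. c k * of_real (J k)) = of_real (Gamma (1 - \<alpha>)) * mittag_leffler \<alpha> 1 z"
    unfolding cJ by (rule sums_unique [symmetric, OF sums_mult]) (use assms in \<open>auto intro: sums_mittag_leffler\<close>)
  with has_integral_suminf_absolutely [OF KJ K0 sJ sK]
  have "((\<lambda>s. \<Sum>k. c k * of_real (K k s)) has_integral of_real (Gamma (1 - \<alpha>)) * mittag_leffler \<alpha> 1 z) {0..1}"
    by simp
  then show ?thesis
    unfolding z_def w_def [symmetric]
    by (rule has_integral_eq [rotated]) (use ws in \<open>simp add: sums_iff w_def\<close>)
qed

text \<open>The weight has mass \<open>Gamma \<alpha> * Gamma (1 - \<alpha>)\<close>, which cancels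
  exactly against the bound \<open>1 / Gamma \<alpha>\<close> for the integrand and the prefactor
  \<open>Gamma (1 - \<alpha>)\<close>.\<close>

lemma norm_mittag_leffler_1_imag_le:
  fixes y :: real
  assumes "0 < \<alpha>" "\<alpha> < 1"
  shows "norm (mittag_leffler \<alpha> 1 (\<i> * of_real y)) \<le> 1"
proof -
  have G: "0 < Gamma \<alpha>" "0 < Gamma (1 - \<alpha>)" using assms by auto
  have "((\<lambda>s. s powr (\<alpha> - 1) * (1 - s) powr (1 - \<alpha> - 1)) has_integral Beta \<alpha> (1 - \<alpha>)) {0..1}"
    using assms by (intro has_integral_Beta_real) auto
  from has_integral_mult_right [OF this, of "1 / Gamma \<alpha>"]
  have B: "((\<lambda>s. 1 / Gamma \<alpha> * (s powr (\<alpha> - 1) * (1 - s) powr (- \<alpha>))) has_integral Gamma (1 - \<alpha>)) {0..1}"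
    using G by (simp add: Beta_def)
  have "norm (of_real (Gamma (1 - \<alpha>)) * mittag_leffler \<alpha> 1 (\<i> * of_real y)) \<le> Gamma (1 - \<alpha>)"
  \<comment> \<open>The real majorant is treated as the component of a Euclidean function along the
    basis vector 1.\<close>
  proof (rule has_integral_norm_bound_integral_component [of _ _ _ _ _ "1::real", simplified inner_real_def mult_1_right,
        OF mittag_leffler_1_has_integral [OF assms] B])
    fix s :: real assume "s \<in> {0..1}"
    show "norm (of_real ((1 - s) powr (- \<alpha>) * s powr (\<alpha> - 1)) *
      mittag_leffler \<alpha> \<alpha> (\<i> * of_real (y * s powr \<alpha>)))
      \<le> 1 / Gamma \<alpha> * (s powr (\<alpha> - 1) * (1 - s) powr (- \<alpha>))"
      using mult_left_mono [OF norm_mittag_leffler_imag_le [OF assms, of "y * s powr \<alpha>"],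
          of "s powr (\<alpha> - 1) * (1 - s) powr (- \<alpha>)"]
      by (simp add: norm_mult mult_ac)
  qed
  then show ?thesis using G by (simp add: norm_mult)
qed

lemma has_vector_derivative_mittag_leffler_1_imag:
  assumes "0 < \<alpha>"
  shows "((\<lambda>y. mittag_leffler \<alpha> 1 (\<i> * of_real y)) has_vector_derivative
     \<i> / of_real \<alpha> * mittag_leffler \<alpha> \<alpha> (\<i> * of_real y)) (at y)"
proof -
  have "((\<lambda>y. \<i> * complex_of_real y) has_vector_derivative \<i>) (at y)"
    by (auto intro!: derivative_eq_intros)
  from field_vector_diff_chain_at [OF this has_field_derivative_mittag_leffler_1 [OF assms]]
  show ?thesis by (simp add: o_def mult_ac)
qed

text \<open>The \<open>\<alpha>\<close> from differentiating \<open>s powr \<alpha>\<close> cancels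
  the \<open>1 / \<alpha>\<close> of the complex derivative. Up to \<open>\<i> * y\<close>, the
  symbol of P is thus the time derivative of the symbol of S.\<close>

lemma has_vector_derivative_mittag_leffler_1_powr:
  assumes "0 < \<alpha>" "0 < s"
  shows "((\<lambda>s. mittag_leffler \<alpha> 1 (\<i> * of_real (y * s powr \<alpha>))) has_vector_derivative
     \<i> * of_real y * of_real (s powr (\<alpha> - 1)) * mittag_leffler \<alpha> \<alpha> (\<i> * of_real (y * s powr \<alpha>))) (at s)"
proof -
  have "((\<lambda>s. y * s powr \<alpha>) has_real_derivative y * (\<alpha> * s powr (\<alpha> - 1))) (at s)"
    using assms by (auto intro!: derivative_eq_intros)
  then have "((\<lambda>s. y * s powr \<alpha>) has_vector_derivative y * (\<alpha> * s powr (\<alpha> - 1))) (at s)"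
    by (simp add: has_real_derivative_iff_has_vector_derivative)
  from vector_diff_chain_at [OF this has_vector_derivative_mittag_leffler_1_imag [OF assms(1)]]
  show ?thesis using assms by (simp add: o_def scaleR_conv_of_real mult_ac)
qed

lemma continuous_on_mittag_leffler_imag:
  assumes "0 < \<alpha>" "0 < \<beta>" "continuous_on S h"
  shows "continuous_on S (\<lambda>x. mittag_leffler \<alpha> \<beta> (\<i> * of_real (h x)))"
proof -
  have "continuous_on UNIV (mittag_leffler \<alpha> \<beta>)"
    using isCont_mittag_leffler [OF assms(1,2)] by (simp add: continuous_at_imp_continuous_on)
  moreover have "continuous_on S (\<lambda>x. \<i> * complex_of_real (h x))"
    using assms(3) by (intro continuous_intros)
  ultimately show ?thesis by (rule continuous_on_compose2) auto
qed

text \<open>The integral representation is cut at a point \<open>s < 1\<close> that depends only on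
  \<open>e\<close> and \<alpha>: beyond it the weight has little mass, uniformly in
  \<open>y\<close>; before it one integration by parts gains a factor
  \<open>1 / norm y\<close>.\<close>

lemma tendsto_mittag_leffler_1_imag:
  assumes "0 < \<alpha>" "\<alpha> < 1"
  shows "((\<lambda>y::real. mittag_leffler \<alpha> 1 (\<i> * of_real y)) \<longlongrightarrow> 0) at_infinity"
proof (rule tendstoI)
  fix e :: real assume e: "0 < e"
  define w where "w = (\<lambda>s::real. (1 - s) powr (- \<alpha>) * s powr (\<alpha> - 1))"
  define f where "f = (\<lambda>y. mittag_leffler \<alpha> \<alpha> (\<i> * of_real y))"
  define g where "g = (\<lambda>y. mittag_leffler \<alpha> 1 (\<i> * of_real y))"
  have G: "0 < Gamma \<alpha>" "0 < Gamma (1 - \<alpha>)" using assms by auto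
  have wi: "w integrable_on {0..1}"
    using has_integral_Beta_real [of \<alpha> "1 - \<alpha>"] assms
    by (auto simp: w_def mult.commute intro: has_integral_integrable)
  have "continuous_on {0..1} (\<lambda>s. integral {s..1} w)"
    using indefinite_integral_continuous_1' [OF wi] .
  then have "((\<lambda>s. integral {s..1} w) \<longlongrightarrow> integral {1..1} w) (at_left 1)"
    by (rule continuous_on_Icc_at_leftD) simp
  then have "((\<lambda>s. integral {s..1} w) \<longlongrightarrow> 0) (at_left 1)" by simp
  \<comment> \<open>Divided by \<open>Gamma \<alpha>\<close>, the bound for the integrand, this is
    half of the allowance \<open>e * Gamma (1 - \<alpha>)\<close>.\<close>
  then have "\<forall>\<^sub>F s in at_left 1. integral {s..1} w < e * Gamma \<alpha> * Gamma (1 - \<alpha>) / 2"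
    using e G by (intro order_tendstoD) auto
  moreover have "\<forall>\<^sub>F s::real in at_left 1. s \<in> {0<..<1}"
    by (rule eventually_at_leftI [of 0]) auto
  ultimately have "\<forall>\<^sub>F s in at_left 1. integral {s..1} w < e * Gamma \<alpha> * Gamma (1 - \<alpha>) / 2 \<and> s \<in> {0<..<1}"
    by (rule eventually_conj)
  then obtain s where s: "0 < s" "s < 1" and ws: "integral {s..1} w < e * Gamma \<alpha> * Gamma (1 - \<alpha>) / 2"
    using eventually_happens' [OF trivial_limit_at_left_real] by force
  \<comment> \<open>The three terms bound the boundary value at \<open>s\<close>, the boundary value
    at 0 and the integral of \<open>L\<close>.\<close>
  define B where "B = (1 - s) powr (- \<alpha>) + 1 + \<alpha> * (1 - s) powr (- \<alpha> - 1)"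
  have B: "1 \<le> B" using assms by (simp add: B_def)
  \<comment> \<open>The threshold makes \<open>B / norm y\<close> less than the other half of the
    allowance; the summand 1 keeps \<open>y\<close> away from 0 and the inequality strict.\<close>
  have bound: "norm (g y) < e" if y: "2 * B / (e * Gamma (1 - \<alpha>)) + 1 \<le> norm y" for y :: real
  proof -
    define F where "F = (\<lambda>s. of_real (w s) * f (y * s powr \<alpha>))"
    have F: "(F has_integral of_real (Gamma (1 - \<alpha>)) * g y) {0..1}"
      unfolding F_def w_def f_def g_def using assms by (rule mittag_leffler_1_has_integral)
    then have Fi: "F integrable_on {0..1}" by blast
    have Fi0: "F integrable_on {0..s}" and Fi1: "F integrable_on {s..1}"
      using s by (auto intro: integrable_subinterval_real [OF Fi])
    have split: "integral {0..s} F + integral {s..1} F = of_real (Gamma (1 - \<alpha>)) * g y"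
      using Henstock_Kurzweil_Integration.integral_combine [of 0 s 1 F] s Fi integral_unique [OF F] by simp
    have far: "norm (integral {s..1} F) \<le> 1 / Gamma \<alpha> * integral {s..1} w"
    proof -
      have wi1: "w integrable_on {s..1}" using s by (auto intro: integrable_subinterval_real [OF wi])
      have "norm (integral {s..1} F) \<le> integral {s..1} (\<lambda>r. 1 / Gamma \<alpha> * w r)"
      proof (rule Henstock_Kurzweil_Integration.integral_norm_bound_integral [OF Fi1])
        show "(\<lambda>r. 1 / Gamma \<alpha> * w r) integrable_on {s..1}"
          using integrable_on_cmult_left [OF wi1, of "1 / Gamma \<alpha>"] by simp
        fix r
        have "0 \<le> w r" by (simp add: w_def)
        from mult_left_mono [OF norm_mittag_leffler_imag_le [OF assms, of "y * r powr \<alpha>"] this]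
        show "norm (F r) \<le> 1 / Gamma \<alpha> * w r"
          using \<open>0 \<le> w r\<close> by (simp add: F_def f_def norm_mult mult_ac)
      qed
      then show ?thesis by simp
    qed
    have near: "norm y * norm (integral {0..s} F) \<le> B"
    proof -
      \<comment> \<open>\<open>H\<close> differentiates to \<open>\<i> * y * F + L\<close>. The
        singularity of the weight at 0 sits entirely in \<open>F\<close>, and \<open>L\<close>,
        which comes from differentiating the weight \<open>(1 - r) powr (- \<alpha>)\<close>, is
        bounded on \<open>[0, s]\<close>.\<close>
      define H where "H = (\<lambda>r. of_real ((1 - r) powr (- \<alpha>)) * g (y * r powr \<alpha>))"
      define L where "L = (\<lambda>r. of_real (\<alpha> * (1 - r) powr (- \<alpha> - 1)) * g (y * r powr \<alpha>))"
      have cg: "continuous_on {0..s} (\<lambda>r. g (y * r powr \<alpha>))"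
        unfolding g_def using assms s
        by (intro continuous_on_mittag_leffler_imag continuous_intros continuous_on_powr') auto
      have cp: "continuous_on {0..s} (\<lambda>r. (1 - r) powr b)" for b
        using s by (intro continuous_intros) auto
      have cH: "continuous_on {0..s} H" unfolding H_def by (intro continuous_intros cg cp)
      have cL: "continuous_on {0..s} L" unfolding L_def by (intro continuous_intros cg cp)
      have dH: "(H has_vector_derivative (\<i> * of_real y * F r + L r)) (at r)" if "r \<in> {0<..<s}" for r
      proof -
        have "((\<lambda>r. (1 - r) powr (- \<alpha>)) has_real_derivative \<alpha> * (1 - r) powr (- \<alpha> - 1)) (at r)"
          using that s by (auto intro!: derivative_eq_intros)
        then have "((\<lambda>r. complex_of_real ((1 - r) powr (- \<alpha>))) has_vector_derivative of_real (\<alpha> * (1 - r) powr (- \<alpha> - 1))) (at r)"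
          by (intro has_vector_derivative_of_real) (simp add: has_real_derivative_iff_has_vector_derivative)
        from has_vector_derivative_mult [OF this has_vector_derivative_mittag_leffler_1_powr [of \<alpha> r y]]
        show ?thesis
          unfolding H_def using that assms by (simp add: F_def L_def w_def f_def g_def algebra_simps)
      qed
      have "((\<lambda>r. \<i> * of_real y * F r + L r) has_integral (H s - H 0)) {0..s}"
        using s cH dH by (intro fundamental_theorem_of_calculus_interior) auto
      moreover have Li: "(L has_integral integral {0..s} L) {0..s}"
        using cL by (intro integrable_integral integrable_continuous_real)
      ultimately have "((\<lambda>r. \<i> * of_real y * F r) has_integral (H s - H 0 - integral {0..s} L)) {0..s}"
        using has_integral_diff [of "\<lambda>r. \<i> * of_real y * F r + L r" _ _ L] by simp
      moreover have "((\<lambda>r. \<i> * of_real y * F r) has_integral \<i> * of_real y * integral {0..s} F) {0..s}"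
        using Fi0 by (intro has_integral_mult_right integrable_integral)
      ultimately have e: "H s - H 0 - integral {0..s} L = \<i> * of_real y * integral {0..s} F"
        by (rule has_integral_unique)
      have "norm y * norm (integral {0..s} F) = norm (H s - H 0 - integral {0..s} L)"
        unfolding e by (simp add: norm_mult)
      also have "\<dots> \<le> norm (H s) + norm (H 0) + norm (integral {0..s} L)"
        using norm_triangle_ineq4 [of "H s - H 0" "integral {0..s} L"] norm_triangle_ineq4 [of "H s" "H 0"] by linarith
      finally have sum: "norm y * norm (integral {0..s} F) \<le> \<dots>" .
      have Hle: "norm (H r) \<le> (1 - r) powr (- \<alpha>)" for r
        using norm_mittag_leffler_1_imag_le [OF assms, of "y * r powr \<alpha>"]
        by (simp add: H_def g_def norm_mult mult_left_le)
      have "norm (integral {0..s} L) \<le> \<alpha> * (1 - s) powr (- \<alpha> - 1) * (s - 0)"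
      proof (rule integral_bound [OF _ cL])
        fix r assume r: "r \<in> {0..s}"
        have "norm (L r) \<le> \<alpha> * (1 - r) powr (- \<alpha> - 1)"
          using norm_mittag_leffler_1_imag_le [OF assms, of "y * r powr \<alpha>"] assms
          by (simp add: L_def g_def norm_mult mult_left_le)
        also have "\<dots> \<le> \<alpha> * (1 - s) powr (- \<alpha> - 1)"
          using r s assms by (intro mult_left_mono powr_mono2') auto
        finally show "norm (L r) \<le> \<alpha> * (1 - s) powr (- \<alpha> - 1)" .
      qed (use s in auto)
      also have "\<alpha> * (1 - s) powr (- \<alpha> - 1) * (s - 0) \<le> \<alpha> * (1 - s) powr (- \<alpha> - 1)"
        using s assms by (intro mult_left_le) auto
      finally show ?thesis using sum Hle [of s] Hle [of 0] by (simp add: B_def)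
    qed
    have y0: "0 < norm y" 
    proof -
      have "0 \<le> 2 * B / (e * Gamma (1 - \<alpha>))" using B e G by simp
      then show ?thesis using y by linarith
    qed
    have "2 * B / (e * Gamma (1 - \<alpha>)) < norm y" using y by linarith
    then have "2 * B < norm y * (e * Gamma (1 - \<alpha>))" using e G by (simp add: pos_divide_less_eq)
    then have "norm y * norm (integral {0..s} F) < norm y * (e * Gamma (1 - \<alpha>) / 2)" using near by simp
    then have 1: "norm (integral {0..s} F) < e * Gamma (1 - \<alpha>) / 2" using y0 by simp
    have "1 / Gamma \<alpha> * integral {s..1} w < e * Gamma (1 - \<alpha>) / 2"
      using ws G by (simp add: field_simps)
    then have "norm (integral {0..s} F + integral {s..1} F) < e * Gamma (1 - \<alpha>)"
      using 1 far norm_triangle_ineq [of "integral {0..s} F" "integral {s..1} F"] by linarith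
    then have "Gamma (1 - \<alpha>) * norm (g y) < Gamma (1 - \<alpha>) * e"
      unfolding split using G by (simp add: norm_mult mult.commute)
    then show ?thesis using G by simp
  qed
  then show "\<forall>\<^sub>F y::real in at_infinity. dist (mittag_leffler \<alpha> 1 (\<i> * of_real y)) 0 < e"
    unfolding eventually_at_infinity by (auto simp: g_def)
qed


section \<open>Time integrals of the singular kernel\<close>

lemma integrable_powr_diff:
  fixes t \<alpha> :: real
  assumes "0 < \<alpha>"
  shows "integrable lborel (\<lambda>s. indicator {0<..<t} s * (t - s) powr (\<alpha> - 1))"
proof (cases "0 < t")
  case True
  have "((\<lambda>s. (t - s) powr (\<alpha> - 1)) has_integral (- ((t - t) powr \<alpha> / \<alpha>) - - ((t - 0) powr \<alpha> / \<alpha>))) {0..t}"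
  proof (rule fundamental_theorem_of_calculus_interior)
    show "continuous_on {0..t} (\<lambda>s. - ((t - s) powr \<alpha> / \<alpha>))"
      using assms by (intro continuous_intros continuous_on_powr') auto
    fix s assume "s \<in> {0<..<t}"
    then have "((\<lambda>s. - ((t - s) powr \<alpha> / \<alpha>)) has_real_derivative (t - s) powr (\<alpha> - 1)) (at s)"
      using assms by (auto intro!: derivative_eq_intros)
    then show "((\<lambda>s. - ((t - s) powr \<alpha> / \<alpha>)) has_vector_derivative (t - s) powr (\<alpha> - 1)) (at s)"
      by (simp add: has_real_derivative_iff_has_vector_derivative)
  qed (use True in auto)
  then have "(\<lambda>s. (t - s) powr (\<alpha> - 1)) absolutely_integrable_on {0..t}"
    by (intro nonnegative_absolutely_integrable_1) auto
  then have "(\<lambda>s. (t - s) powr (\<alpha> - 1)) absolutely_integrable_on {0<..<t}"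
    by (rule set_integrable_subset) auto
  then show ?thesis
    unfolding set_integrable_def real_scaleR_def by (subst (asm) integrable_completion) auto
qed simp

text \<open>Scalar form of the action of G on constants: the integrand is the derivative of
  \<open>- g\<close>, and the end \<open>s = t\<close> contributes
  \<open>mittag_leffler \<alpha> 1 0 = 1\<close>.\<close>

lemma integral_mittag_leffler_powr_diff:
  fixes t y :: real
  assumes "0 < \<alpha>" "\<alpha> < 1" "0 \<le> t"
  shows "(LINT s|lborel. \<i> * of_real y * (of_real (indicator {0<..<t} s * (t - s) powr (\<alpha> - 1)) *
      mittag_leffler \<alpha> \<alpha> (\<i> * of_real (y * (t - s) powr \<alpha>))))
    = mittag_leffler \<alpha> 1 (\<i> * of_real (y * t powr \<alpha>)) - 1"
proof -
  define g where "g = (\<lambda>s. mittag_leffler \<alpha> 1 (\<i> * of_real (y * (t - s) powr \<alpha>)))"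
  define h where "h = (\<lambda>s. \<i> * of_real y * (of_real ((t - s) powr (\<alpha> - 1)) *
      mittag_leffler \<alpha> \<alpha> (\<i> * of_real (y * (t - s) powr \<alpha>))))"
  have hm: "(\<lambda>s. indicator {0<..<t} s *\<^sub>R h s) \<in> borel_measurable borel"
  proof (rule borel_measurable_continuous_on_indicator)
    show "continuous_on {0<..<t} h" unfolding h_def
      using assms by (intro continuous_intros continuous_on_mittag_leffler_imag continuous_on_powr') auto
  qed auto
  \<comment> \<open>Absolute integrability, from the bound \<open>1 / Gamma \<alpha>\<close>,
    identifies the gauge integral given by the fundamental theorem with the Lebesgue
    integral.\<close>
  have hi: "h absolutely_integrable_on {0<..<t}"
    unfolding set_integrable_def
  proof (rule Bochner_Integration.integrable_bound)
    show "integrable lebesgue (\<lambda>s. \<bar>y\<bar> / Gamma \<alpha> * (indicator {0<..<t} s * (t - s) powr (\<alpha> - 1)))"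
      using integrable_powr_diff [OF assms(1)] by (subst integrable_completion) auto
    show "AE s in lebesgue. norm (indicator {0<..<t} s *\<^sub>R h s)
        \<le> norm (\<bar>y\<bar> / Gamma \<alpha> * (indicator {0<..<t} s * (t - s) powr (\<alpha> - 1)))"
    proof (intro AE_I2)
      fix s
      have "norm (h s) \<le> \<bar>y\<bar> / Gamma \<alpha> * (t - s) powr (\<alpha> - 1)"
        using mult_left_mono [OF norm_mittag_leffler_imag_le [OF assms(1,2), of "y * (t - s) powr \<alpha>"],
            of "\<bar>y\<bar> * (t - s) powr (\<alpha> - 1)"]
        by (simp add: h_def norm_mult mult_ac)
      then show "norm (indicator {0<..<t} s *\<^sub>R h s)
        \<le> norm (\<bar>y\<bar> / Gamma \<alpha> * (indicator {0<..<t} s * (t - s) powr (\<alpha> - 1)))"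
        using assms by (auto simp: indicator_def Gamma_real_pos abs_mult)
    qed
  qed (use hm in \<open>auto intro: measurable_completion\<close>)
  have "(h has_integral (- g t - - g 0)) {0..t}"
  proof (rule fundamental_theorem_of_calculus_interior)
    show "continuous_on {0..t} (\<lambda>s. - g s)"
      unfolding g_def using assms
      by (intro continuous_intros continuous_on_mittag_leffler_imag continuous_on_powr') auto
    fix s assume s: "s \<in> {0<..<t}"
    have "((\<lambda>s. t - s) has_vector_derivative - 1) (at s)"
      by (auto intro!: derivative_eq_intros)
    from vector_diff_chain_at [OF this has_vector_derivative_mittag_leffler_1_powr [of \<alpha> "t - s" y]]
    have "(g has_vector_derivative - h s) (at s)"
      using assms s by (simp add: o_def g_def h_def mult_ac)
    then show "((\<lambda>s. - g s) has_vector_derivative h s) (at s)"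
      using has_vector_derivative_minus by fastforce
  qed (use assms in auto)
  then have "(h has_integral (g 0 - g t)) {0<..<t}"
    by (simp add: has_integral_Icc_iff_Ioo)
  then have "(LINT s:{0<..<t}|lebesgue. h s) = g 0 - g t"
    using set_lebesgue_integral_eq_integral(2) [OF hi] by (simp add: integral_unique)
  moreover have "(LINT s:{0<..<t}|lebesgue. h s) = (LINT s|lborel. indicator {0<..<t} s *\<^sub>R h s)"
    unfolding set_lebesgue_integral_def using hm by (intro integral_completion) auto
  moreover have "g t = 1" using mittag_leffler_0 [of \<alpha> 1] by (simp add: g_def)
  ultimately show ?thesis
    by (simp add: g_def h_def scaleR_conv_of_real mult_ac)
qed

section \<open>Complex Hilbert spaces: norm and inner product\<close>

lemma norm_scaleC: "norm (c *\<^sub>C x) = cmod c * norm (x :: 'a::complex_hilbert)"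
proof -
  have "cinner x (c *\<^sub>C x) = cnj c * cinner x x"
    by (simp add: cinner_commute [of x "c *\<^sub>C x"] cinner_scaleC_left cinner_commute [of x x, symmetric])
  then have "complex_of_real ((norm (c *\<^sub>C x))\<^sup>2) = c * cnj c * complex_of_real ((norm x)\<^sup>2)"
    unfolding cinner_self [symmetric] by (simp add: cinner_scaleC_left)
  also have "\<dots> = complex_of_real ((cmod c * norm x)\<^sup>2)"
    by (simp add: complex_norm_square power_mult_distrib del: of_real_power)
  finally have "(norm (c *\<^sub>C x))\<^sup>2 = (cmod c * norm x)\<^sup>2"
    by (simp only: of_real_eq_iff)
  then show ?thesis by simp
qed

text \<open>Cauchy-Schwarz is read off from the triangle inequality, which the class
  \<open>banach\<close> provides, by expanding the squares of \<open>norm (x + y)\<close> and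
  \<open>norm x + norm y\<close>.\<close>

lemma Re_cinner_le: "Re (cinner x y) \<le> norm x * norm (y :: 'a::complex_hilbert)"
proof -
  have r: "cinner z (x + y) = cinner z x + cinner z y" for z
    by (simp add: cinner_commute [of z] cinner_add_left)
  have "complex_of_real ((norm (x + y))\<^sup>2) = complex_of_real ((norm x)\<^sup>2) + cinner x y + cnj (cinner x y) + complex_of_real ((norm y)\<^sup>2)"
    using cinner_commute [of y x] unfolding cinner_self [symmetric] by (simp add: cinner_add_left r)
  from arg_cong [OF this, of Re] have "(norm (x + y))\<^sup>2 = (norm x)\<^sup>2 + (norm y)\<^sup>2 + 2 * Re (cinner x y)"
    by (simp del: of_real_power)
  moreover have "(norm (x + y))\<^sup>2 \<le> (norm x + norm y)\<^sup>2"
    by (intro power_mono norm_triangle_ineq) simp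
  ultimately show ?thesis by (simp add: power2_sum)
qed

lemma norm_cinner_le: "cmod (cinner x y) \<le> norm x * norm (y :: 'a::complex_hilbert)"
proof -
  \<comment> \<open>Rotates the inner product onto the nonnegative real axis; as
    \<open>sgn 0 = 0\<close>, only \<open>cmod c \<le> 1\<close> holds in general.\<close>
  define c where "c = cnj (sgn (cinner x y))"
  have "cmod c \<le> 1" by (simp add: c_def norm_sgn)
  have "c * cinner x y = complex_of_real (cmod (cinner x y))"
    by (simp add: c_def sgn_eq complex_norm_square [symmetric] power2_eq_square mult.commute)
  then have "cmod (cinner x y) = Re (cinner (c *\<^sub>C x) y)"
    by (simp add: cinner_scaleC_left)
  also have "\<dots> \<le> norm (c *\<^sub>C x) * norm y" by (rule Re_cinner_le)
  also have "\<dots> \<le> norm x * norm y"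
    using \<open>cmod c \<le> 1\<close> by (simp add: norm_scaleC mult_left_le_one_le mult_right_mono)
  finally show ?thesis .
qed

lemma bounded_linear_cinner_left: "bounded_linear (\<lambda>x :: 'a::complex_hilbert. cinner x v)"
proof (rule bounded_linear_intro)
  show "cinner (r *\<^sub>R x) v = r *\<^sub>R cinner x v" for r x
    using cinner_scaleC_left [of "complex_of_real r" x v] by (simp add: scaleC_of_real scaleR_conv_of_real)
  show "cmod (cinner x v) \<le> norm x * norm v" for x by (rule norm_cinner_le)
qed (simp add: cinner_add_left)

lemma cinner_eqI:
  fixes x y :: "'a::complex_hilbert"
  assumes "\<And>v. cinner x v = cinner y v"
  shows "x = y"
proof -
  interpret bounded_linear "\<lambda>z. cinner z (x - y)" by (rule bounded_linear_cinner_left)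
  have "cinner (x - y) (x - y) = 0" using assms by (simp add: diff)
  then show ?thesis by (simp add: cinner_self)
qed

lemma bounded_linear_scaleC: "bounded_linear (\<lambda>x :: 'a::complex_hilbert. c *\<^sub>C x)"
proof (rule bounded_linear_intro)
  show "c *\<^sub>C (r *\<^sub>R x) = r *\<^sub>R (c *\<^sub>C x)" for r and x :: 'a
    by (simp only: scaleC_of_real [symmetric] scaleC_scaleC mult.commute)
  show "norm (c *\<^sub>C x) \<le> norm x * cmod c" for x :: 'a
    by (simp add: norm_scaleC mult.commute)
qed (simp add: scaleC_add_right)

section \<open>Square-integrable representatives\<close>

lemma L2_mult_bounded:
  assumes "f \<in> L2 M" "m \<in> borel_measurable M" "\<And>\<xi>. cmod (m \<xi>) \<le> C"
  shows "(\<lambda>\<xi>. m \<xi> * f \<xi>) \<in> L2 M"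
proof -
  have [measurable]: "f \<in> borel_measurable M" "m \<in> borel_measurable M"
    and I: "integrable M (\<lambda>\<xi>. (cmod (f \<xi>))\<^sup>2)"
    using assms by (auto simp: L2_def)
  have "integrable M (\<lambda>\<xi>. (cmod (m \<xi> * f \<xi>))\<^sup>2)"
  proof (rule Bochner_Integration.integrable_bound [of M "\<lambda>\<xi>. C\<^sup>2 * (cmod (f \<xi>))\<^sup>2", OF _ _ AE_I2])
    fix \<xi>
    show "norm ((cmod (m \<xi> * f \<xi>))\<^sup>2) \<le> norm (C\<^sup>2 * (cmod (f \<xi>))\<^sup>2)"
      using assms(3) [of \<xi>] by (simp add: norm_mult power_mult_distrib mult_right_mono power_mono)
  qed (use I in auto)
  then show ?thesis by (simp add: L2_def)
qed

lemma L2_cmult: "f \<in> L2 M \<Longrightarrow> (\<lambda>\<xi>. c * f \<xi>) \<in> L2 M"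
  by (rule L2_mult_bounded [where C = "cmod c"]) auto

lemma L2_add:
  assumes "f \<in> L2 M" "g \<in> L2 M"
  shows "(\<lambda>\<xi>. f \<xi> + g \<xi>) \<in> L2 M"
proof -
  have [measurable]: "f \<in> borel_measurable M" "g \<in> borel_measurable M"
    and I: "integrable M (\<lambda>\<xi>. (cmod (f \<xi>))\<^sup>2)" "integrable M (\<lambda>\<xi>. (cmod (g \<xi>))\<^sup>2)"
    using assms by (auto simp: L2_def)
  have "integrable M (\<lambda>\<xi>. (cmod (f \<xi> + g \<xi>))\<^sup>2)"
  proof (rule Bochner_Integration.integrable_bound [of M "\<lambda>\<xi>. 2 * (cmod (f \<xi>))\<^sup>2 + 2 * (cmod (g \<xi>))\<^sup>2", OF _ _ AE_I2])
    fix \<xi>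
    have "(cmod (f \<xi> + g \<xi>))\<^sup>2 \<le> (cmod (f \<xi>) + cmod (g \<xi>))\<^sup>2"
      by (intro power_mono norm_triangle_ineq) simp
    also have "\<dots> \<le> 2 * (cmod (f \<xi>))\<^sup>2 + 2 * (cmod (g \<xi>))\<^sup>2"
      using sum_squares_bound [of "cmod (f \<xi>)" "cmod (g \<xi>)"] by (simp add: power2_sum)
    finally show "norm ((cmod (f \<xi> + g \<xi>))\<^sup>2) \<le> norm (2 * (cmod (f \<xi>))\<^sup>2 + 2 * (cmod (g \<xi>))\<^sup>2)"
      by simp
  qed (use I in auto)
  then show ?thesis by (simp add: L2_def)
qed

lemma L2_diff: "f \<in> L2 M \<Longrightarrow> g \<in> L2 M \<Longrightarrow> (\<lambda>\<xi>. f \<xi> - g \<xi>) \<in> L2 M"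
  using L2_add [of f M "\<lambda>\<xi>. - 1 * g \<xi>"] L2_cmult [of g M "- 1"] by simp

lemma L2_AE_cong:
  assumes "f \<in> L2 M" "g \<in> borel_measurable M" "AE \<xi> in M. g \<xi> = f \<xi>"
  shows "g \<in> L2 M"
proof -
  have [measurable]: "f \<in> borel_measurable M" "g \<in> borel_measurable M"
    and "integrable M (\<lambda>\<xi>. (cmod (f \<xi>))\<^sup>2)"
    using assms by (auto simp: L2_def)
  moreover have "AE \<xi> in M. (cmod (f \<xi>))\<^sup>2 = (cmod (g \<xi>))\<^sup>2" using assms(3) by eventually_elim simp
  ultimately have "integrable M (\<lambda>\<xi>. (cmod (g \<xi>))\<^sup>2)"
    by (subst (asm) integrable_cong_AE) auto
  then show ?thesis using assms by (simp add: L2_def)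
qed

lemma L2_mult_integrable:
  assumes "f \<in> L2 M" "g \<in> L2 M"
  shows "integrable M (\<lambda>\<xi>. f \<xi> * cnj (g \<xi>))"
proof -
  have [measurable]: "f \<in> borel_measurable M" "g \<in> borel_measurable M"
    and I: "integrable M (\<lambda>\<xi>. (cmod (f \<xi>))\<^sup>2)" "integrable M (\<lambda>\<xi>. (cmod (g \<xi>))\<^sup>2)"
    using assms by (auto simp: L2_def)
  have [measurable]: "(\<lambda>\<xi>. cnj (g \<xi>)) \<in> borel_measurable M"
    by (rule measurable_compose [of g M borel]) (auto intro!: borel_measurable_continuous_onI continuous_intros)
  show ?thesis
  proof (rule Bochner_Integration.integrable_bound [of M "\<lambda>\<xi>. (cmod (f \<xi>))\<^sup>2 + (cmod (g \<xi>))\<^sup>2" "\<lambda>\<xi>. f \<xi> * cnj (g \<xi>)", OF _ _ AE_I2])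
    fix \<xi>
    have "0 \<le> cmod (f \<xi>) * cmod (g \<xi>)" by simp
    then have "cmod (f \<xi>) * cmod (g \<xi>) \<le> (cmod (f \<xi>))\<^sup>2 + (cmod (g \<xi>))\<^sup>2"
      using sum_squares_bound [of "cmod (f \<xi>)" "cmod (g \<xi>)"] by linarith
    then show "norm (f \<xi> * cnj (g \<xi>)) \<le> norm ((cmod (f \<xi>))\<^sup>2 + (cmod (g \<xi>))\<^sup>2)"
      by (simp add: norm_mult)
  qed (use I in auto)
qed

section \<open>The unitary map and multiplication operators\<close>

text \<open>Common form of \<open>S_op\<close> and \<open>P_op\<close>, so that bounds and strong
  convergence are proved once. Measurability and boundedness of the symbol are left to the
  lemmas.\<close>

definition mult_op ::
  "'w measure \<Rightarrow> (('w \<Rightarrow> complex) \<Rightarrow> 'h) \<Rightarrow> ('w \<Rightarrow> complex) \<Rightarrow> 'h \<Rightarrow> 'h"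
  where "mult_op M U m \<phi> = U (\<lambda>\<xi>. m \<xi> * Uinv M U \<phi> \<xi>)"

context
  fixes M :: "'w measure" and U :: "('w \<Rightarrow> complex) \<Rightarrow> 'h::complex_hilbert"
  assumes U: "unitary_L2 M U"
begin

lemma Uinv_L2: "Uinv M U \<phi> \<in> L2 M" and U_Uinv: "U (Uinv M U \<phi>) = \<phi>"
  using U inv_into_into [of \<phi> U "L2 M"] f_inv_into_f [of \<phi> U "L2 M"]
  by (auto simp: unitary_L2_def Uinv_def)

lemma U_add: "f \<in> L2 M \<Longrightarrow> g \<in> L2 M \<Longrightarrow> U (\<lambda>\<xi>. f \<xi> + g \<xi>) = U f + U g"
  and U_cmult: "f \<in> L2 M \<Longrightarrow> U (\<lambda>\<xi>. c * f \<xi>) = c *\<^sub>C U f"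
  and cinner_U: "f \<in> L2 M \<Longrightarrow> g \<in> L2 M \<Longrightarrow> cinner (U f) (U g) = (LINT \<xi>|M. f \<xi> * cnj (g \<xi>))"
  using U by (auto simp: unitary_L2_def)

lemma U_diff:
  assumes "f \<in> L2 M" "g \<in> L2 M"
  shows "U (\<lambda>\<xi>. f \<xi> - g \<xi>) = U f - U g"
proof -
  have "U (\<lambda>\<xi>. - 1 * g \<xi>) = - U g"
    using U_cmult [OF assms(2), of "- 1"] scaleC_of_real [of "- 1" "U g"] by simp
  then show ?thesis
    using U_add [OF assms(1) L2_cmult [OF assms(2), of "- 1"]] by simp
qed

lemma norm_U:
  assumes "f \<in> L2 M"
  shows "(norm (U f))\<^sup>2 = (LINT \<xi>|M. (cmod (f \<xi>))\<^sup>2)"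
proof -
  have "complex_of_real ((norm (U f))\<^sup>2) = (LINT \<xi>|M. complex_of_real ((cmod (f \<xi>))\<^sup>2))"
    unfolding cinner_self [of "U f", symmetric] cinner_U [OF assms assms] complex_norm_square ..
  then show ?thesis by (simp only: integral_complex_of_real of_real_eq_iff)
qed

text \<open>By isometry the squared norm of \<open>U f - U g\<close> is the integral of a
  nonnegative function, which is 0 exactly if that function vanishes almost everywhere.\<close>

lemma U_eq_iff_AE:
  assumes "f \<in> L2 M" "g \<in> L2 M"
  shows "U f = U g \<longleftrightarrow> (AE \<xi> in M. f \<xi> = g \<xi>)"
proof -
  have d: "(\<lambda>\<xi>. f \<xi> - g \<xi>) \<in> L2 M" using assms by (rule L2_diff)
  have "U f = U g \<longleftrightarrow> (norm (U (\<lambda>\<xi>. f \<xi> - g \<xi>)))\<^sup>2 = 0" by (simp add: U_diff [OF assms])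
  also have "\<dots> \<longleftrightarrow> (AE \<xi> in M. (cmod (f \<xi> - g \<xi>))\<^sup>2 = 0)"
    unfolding norm_U [OF d] using d
    by (intro integral_nonneg_eq_0_iff_AE) (auto simp: L2_def)
  finally show ?thesis by simp
qed

lemma Uinv_U: "f \<in> L2 M \<Longrightarrow> AE \<xi> in M. Uinv M U (U f) \<xi> = f \<xi>"
  using U_eq_iff_AE [of "Uinv M U (U f)" f] Uinv_L2 U_Uinv by simp

lemma Uinv_diff: "AE \<xi> in M. Uinv M U (\<phi> - \<psi>) \<xi> = Uinv M U \<phi> \<xi> - Uinv M U \<psi> \<xi>"
proof -
  have "U (\<lambda>\<xi>. Uinv M U \<phi> \<xi> - Uinv M U \<psi> \<xi>) = \<phi> - \<psi>"
    by (simp add: U_diff Uinv_L2 U_Uinv)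
  then show ?thesis
    using U_eq_iff_AE [of "Uinv M U (\<phi> - \<psi>)" "\<lambda>\<xi>. Uinv M U \<phi> \<xi> - Uinv M U \<psi> \<xi>"]
    by (simp add: L2_diff Uinv_L2 U_Uinv)
qed

context
  fixes m :: "'w \<Rightarrow> complex" and C :: real
  assumes m: "m \<in> borel_measurable M" "\<And>\<xi>. cmod (m \<xi>) \<le> C"
begin

text \<open>Frees \<open>mult_op\<close> from the representative chosen by \<open>Uinv\<close>: for
  a vector given as \<open>U f\<close>, the function \<open>f\<close> itself may be used.\<close>

lemma mult_op_U:
  assumes "f \<in> L2 M"
  shows "mult_op M U m (U f) = U (\<lambda>\<xi>. m \<xi> * f \<xi>)"
proof -
  have "AE \<xi> in M. m \<xi> * Uinv M U (U f) \<xi> = m \<xi> * f \<xi>"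
    using Uinv_U [OF assms] by eventually_elim simp
  then show ?thesis
    unfolding mult_op_def
    by (subst U_eq_iff_AE) (auto intro: L2_mult_bounded [OF _ m] assms Uinv_L2)
qed

text \<open>\<open>Uinv\<close> respects differences only almost everywhere, so
  \<open>\<phi> - \<psi>\<close> is first written as \<open>U\<close> of the difference of the
  chosen representatives.\<close>

lemma mult_op_diff: "mult_op M U m (\<phi> - \<psi>) = mult_op M U m \<phi> - mult_op M U m \<psi>"
proof -
  have "mult_op M U m (U (\<lambda>\<xi>. Uinv M U \<phi> \<xi> - Uinv M U \<psi> \<xi>)) = mult_op M U m \<phi> - mult_op M U m \<psi>"
    unfolding mult_op_U [OF L2_diff [OF Uinv_L2 Uinv_L2]]
    unfolding mult_op_def by (simp add: right_diff_distrib U_diff L2_mult_bounded [OF Uinv_L2 m])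
  then show ?thesis by (simp add: U_diff Uinv_L2 U_Uinv)
qed

lemma norm_mult_op_le: "norm (mult_op M U m \<phi>) \<le> C * norm \<phi>"
proof (rule power2_le_imp_le)
  have C: "0 \<le> C" using order_trans [OF norm_ge_zero m(2)] .
  have L: "(\<lambda>\<xi>. m \<xi> * Uinv M U \<phi> \<xi>) \<in> L2 M" by (rule L2_mult_bounded [OF Uinv_L2 m])
  have "(norm (mult_op M U m \<phi>))\<^sup>2 = (LINT \<xi>|M. (cmod (m \<xi> * Uinv M U \<phi> \<xi>))\<^sup>2)"
    unfolding mult_op_def by (rule norm_U [OF L])
  also have "\<dots> \<le> (LINT \<xi>|M. C\<^sup>2 * (cmod (Uinv M U \<phi> \<xi>))\<^sup>2)"
    using L Uinv_L2 [of \<phi>] m(2)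
    by (intro integral_mono) (auto simp: L2_def norm_mult power_mult_distrib intro!: mult_right_mono power_mono)
  also have "\<dots> = C\<^sup>2 * (norm \<phi>)\<^sup>2"
    using norm_U [OF Uinv_L2, of \<phi>] by (simp add: U_Uinv)
  finally show "(norm (mult_op M U m \<phi>))\<^sup>2 \<le> (C * norm \<phi>)\<^sup>2" by (simp add: power_mult_distrib)
  show "0 \<le> C * norm \<phi>" using C by simp
qed

end

text \<open>At the fixed vector \<open>\<phi>'\<close> this is dominated convergence for the squared
  norm; the moving vector is absorbed by the common operator bound \<open>C\<close>.\<close>

lemma mult_op_tendsto:
  fixes m :: "nat \<Rightarrow> 'w \<Rightarrow> complex" and m' :: "'w \<Rightarrow> complex"
  assumes m: "\<And>n. m n \<in> borel_measurable M" "\<And>n \<xi>. cmod (m n \<xi>) \<le> C"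
    and m': "m' \<in> borel_measurable M" "\<And>\<xi>. cmod (m' \<xi>) \<le> C"
    and lim: "AE \<xi> in M. (\<lambda>n. m n \<xi>) \<longlonglongrightarrow> m' \<xi>" and \<phi>: "\<phi> \<longlonglongrightarrow> \<phi>'"
  shows "(\<lambda>n. mult_op M U (m n) (\<phi> n)) \<longlonglongrightarrow> mult_op M U m' \<phi>'"
proof -
  define h where "h = Uinv M U \<phi>'"
  have h: "h \<in> L2 M" unfolding h_def by (rule Uinv_L2)
  then have [measurable]: "h \<in> borel_measurable M" and hi: "integrable M (\<lambda>\<xi>. (cmod (h \<xi>))\<^sup>2)"
    by (auto simp: L2_def)
  note [measurable] = m(1) m'(1)
  have e: "(norm (mult_op M U (m n) \<phi>' - mult_op M U m' \<phi>'))\<^sup>2 = (LINT \<xi>|M. (cmod ((m n \<xi> - m' \<xi>) * h \<xi>))\<^sup>2)" for n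
  proof -
    have "mult_op M U (m n) \<phi>' - mult_op M U m' \<phi>' = U (\<lambda>\<xi>. (m n \<xi> - m' \<xi>) * h \<xi>)"
      using U_diff [OF L2_mult_bounded [OF h m(1,2)] L2_mult_bounded [OF h m']]
      by (simp add: mult_op_def h_def left_diff_distrib)
    moreover have "(\<lambda>\<xi>. (m n \<xi> - m' \<xi>) * h \<xi>) \<in> L2 M"
      using L2_diff [OF L2_mult_bounded [OF h m(1,2)] L2_mult_bounded [OF h m']]
      by (simp add: left_diff_distrib)
    ultimately show ?thesis using norm_U by simp
  qed
  have "(\<lambda>n. LINT \<xi>|M. (cmod ((m n \<xi> - m' \<xi>) * h \<xi>))\<^sup>2) \<longlonglongrightarrow> (LINT \<xi>|M. 0)"
  proof (rule integral_dominated_convergence)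
    \<comment> \<open>The majorant comes from
      \<open>cmod (m n \<xi> - m' \<xi>) \<le> 2 * C\<close>.\<close>
    show "integrable M (\<lambda>\<xi>. (2 * C)\<^sup>2 * (cmod (h \<xi>))\<^sup>2)" using hi by (intro integrable_mult_right)
    show "AE \<xi> in M. (\<lambda>n. (cmod ((m n \<xi> - m' \<xi>) * h \<xi>))\<^sup>2) \<longlonglongrightarrow> 0"
      using lim
    proof eventually_elim
      case (elim \<xi>)
      have "(\<lambda>n. (cmod ((m n \<xi> - m' \<xi>) * h \<xi>))\<^sup>2) \<longlonglongrightarrow> (cmod ((m' \<xi> - m' \<xi>) * h \<xi>))\<^sup>2"
        by (intro tendsto_intros elim)
      then show ?case by simp
    qed
    show "AE \<xi> in M. norm ((cmod ((m n \<xi> - m' \<xi>) * h \<xi>))\<^sup>2) \<le> (2 * C)\<^sup>2 * (cmod (h \<xi>))\<^sup>2" for n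
    proof (intro AE_I2)
      fix \<xi>
      have "cmod (m n \<xi> - m' \<xi>) \<le> 2 * C"
        using norm_triangle_ineq4 [of "m n \<xi>" "m' \<xi>"] m(2) [of n \<xi>] m'(2) [of \<xi>] by linarith
      then have "(cmod (m n \<xi> - m' \<xi>))\<^sup>2 \<le> (2 * C)\<^sup>2" by (intro power_mono) auto
      then show "norm ((cmod ((m n \<xi> - m' \<xi>) * h \<xi>))\<^sup>2) \<le> (2 * C)\<^sup>2 * (cmod (h \<xi>))\<^sup>2"
        by (simp add: norm_mult power_mult_distrib mult_right_mono del: power_mult_numeral)
    qed
  qed auto
  then have "(\<lambda>n. sqrt ((norm (mult_op M U (m n) \<phi>' - mult_op M U m' \<phi>'))\<^sup>2)) \<longlonglongrightarrow> sqrt 0"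
    unfolding e by (intro tendsto_real_sqrt) simp
  then have 1: "(\<lambda>n. norm (mult_op M U (m n) \<phi>' - mult_op M U m' \<phi>')) \<longlonglongrightarrow> 0" by simp
  have 2: "(\<lambda>n. C * norm (\<phi> n - \<phi>')) \<longlonglongrightarrow> 0"
    using tendsto_mult_right_zero [OF tendsto_norm_zero [OF LIM_zero [OF \<phi>]]] .
  have "(\<lambda>n. mult_op M U (m n) (\<phi> n) - mult_op M U m' \<phi>') \<longlonglongrightarrow> 0"
  proof (rule Lim_null_comparison [OF always_eventually, rule_format])
    show "(\<lambda>n. C * norm (\<phi> n - \<phi>') + norm (mult_op M U (m n) \<phi>' - mult_op M U m' \<phi>')) \<longlonglongrightarrow> 0"
      using tendsto_add [OF 2 1] by simp
    fix n
    have "norm (mult_op M U (m n) (\<phi> n) - mult_op M U (m n) \<phi>') \<le> C * norm (\<phi> n - \<phi>')"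
      using norm_mult_op_le [OF m(1,2), of n "\<phi> n - \<phi>'"] by (simp add: mult_op_diff [OF m(1,2)])
    then show "norm (mult_op M U (m n) (\<phi> n) - mult_op M U m' \<phi>')
        \<le> C * norm (\<phi> n - \<phi>') + norm (mult_op M U (m n) \<phi>' - mult_op M U m' \<phi>')"
      using norm_triangle_ineq [of "mult_op M U (m n) (\<phi> n) - mult_op M U (m n) \<phi>'" "mult_op M U (m n) \<phi>' - mult_op M U m' \<phi>'"]
      by simp
  qed
  then show ?thesis by (rule LIM_zero_cancel)
qed

end

section \<open>The families S and P and the operator G\<close>

definition P_symbol :: "('w \<Rightarrow> real) \<Rightarrow> real \<Rightarrow> real \<Rightarrow> 'w \<Rightarrow> complex"
  where "P_symbol a \<alpha> t \<xi> =
    of_real (t powr (\<alpha> - 1)) * mittag_leffler \<alpha> \<alpha> (\<i> * of_real (a \<xi> * t powr \<alpha>))"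

lemma P_op_eq_mult_op: "P_op M U a \<alpha> t = mult_op M U (P_symbol a \<alpha> t)"
  by (simp add: P_op_def [abs_def] mult_op_def [abs_def] P_symbol_def)

lemma S_op_eq_mult_op:
  "S_op M U a \<alpha> t = mult_op M U (\<lambda>\<xi>. mittag_leffler \<alpha> 1 (\<i> * of_real (a \<xi> * t powr \<alpha>)))"
  by (simp add: S_op_def [abs_def] mult_op_def [abs_def])

lemma borel_measurable_mittag_leffler:
  "0 < \<alpha> \<Longrightarrow> 0 < \<beta> \<Longrightarrow> mittag_leffler \<alpha> \<beta> \<in> borel_measurable borel"
  by (intro borel_measurable_continuous_onI continuous_at_imp_continuous_on ballI isCont_mittag_leffler)

lemma G_op_eq_lebesgue_on:
  "G_op M U a \<alpha> v t = (LINT \<tau>|lebesgue_on {0<..<t}. P_op M U a \<alpha> (t - \<tau>) (v \<tau>))"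
  by (simp add: G_op_def set_lebesgue_integral_def integral_restrict_space)

context
  fixes M :: "'w measure" and U :: "('w \<Rightarrow> complex) \<Rightarrow> 'h::{complex_hilbert, second_countable_topology}"
    and a :: "'w \<Rightarrow> real" and \<alpha> :: real
  assumes U: "unitary_L2 M U" and a [measurable]: "a \<in> borel_measurable M"
    and \<alpha>: "0 < \<alpha>" "\<alpha> < 1"
begin

lemma measurable_mittag_leffler [measurable]:
  "mittag_leffler \<alpha> \<alpha> \<in> borel_measurable borel" "mittag_leffler \<alpha> 1 \<in> borel_measurable borel"
  using \<alpha> by (auto intro: borel_measurable_mittag_leffler)

lemma P_symbol_measurable: "P_symbol a \<alpha> t \<in> borel_measurable M"
  unfolding P_symbol_def [abs_def] by measurable

lemma norm_P_symbol_le: "cmod (P_symbol a \<alpha> t \<xi>) \<le> t powr (\<alpha> - 1) / Gamma \<alpha>"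
  using mult_left_mono [OF norm_mittag_leffler_imag_le [OF \<alpha>, of "a \<xi> * t powr \<alpha>"], of "t powr (\<alpha> - 1)"]
  by (simp add: P_symbol_def norm_mult)

lemma norm_P_op_le: "norm (P_op M U a \<alpha> t \<phi>) \<le> t powr (\<alpha> - 1) / Gamma \<alpha> * norm \<phi>"
  unfolding P_op_eq_mult_op by (rule norm_mult_op_le [OF U P_symbol_measurable norm_P_symbol_le])

lemma P_op_diff: "P_op M U a \<alpha> t (\<phi> - \<psi>) = P_op M U a \<alpha> t \<phi> - P_op M U a \<alpha> t \<psi>"
  unfolding P_op_eq_mult_op by (rule mult_op_diff [OF U P_symbol_measurable norm_P_symbol_le])

text \<open>Joint continuity is what makes
  \<open>P_op M U a \<alpha> (t - \<tau>) (v \<tau>)\<close> measurable in \<tau> for merely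
  measurable \<open>v\<close>. Time 0 is excluded because \<open>t powr (\<alpha> - 1)\<close> blows
  up there.\<close>

lemma continuous_on_P_op: "continuous_on ({0<..} \<times> UNIV) (\<lambda>z. P_op M U a \<alpha> (fst z) (snd z))"
proof (rule continuous_on_sequentiallyI)
  fix z :: "nat \<Rightarrow> real \<times> 'h" and z' :: "real \<times> 'h"
  assume "\<forall>n. z n \<in> {0<..} \<times> UNIV" "z' \<in> {0<..} \<times> UNIV" and lim: "z \<longlonglongrightarrow> z'"
  then have pos: "0 < fst z'" by auto
  have t: "(\<lambda>n. fst (z n)) \<longlonglongrightarrow> fst z'" and \<phi>: "(\<lambda>n. snd (z n)) \<longlonglongrightarrow> snd z'"
    using lim by (auto intro: tendsto_intros)
  have tp: "(\<lambda>n. fst (z n) powr b) \<longlonglongrightarrow> fst z' powr b" for b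
    using pos by (intro tendsto_intros t) auto
  \<comment> \<open>A convergent sequence is bounded; the \<open>max\<close> with the limit value
    below gives one bound for all symbols and their limit.\<close>
  obtain K where K: "\<And>n. fst (z n) powr (\<alpha> - 1) \<le> K"
    using BseqE [OF convergent_imp_Bseq [OF convergentI [OF tp [of "\<alpha> - 1"]]]] by auto
  define C where "C = max K (fst z' powr (\<alpha> - 1)) / Gamma \<alpha>"
  have G: "0 < Gamma \<alpha>" using \<alpha> by simp
  have bound: "cmod (P_symbol a \<alpha> t \<xi>) \<le> C" if "t powr (\<alpha> - 1) \<le> max K (fst z' powr (\<alpha> - 1))" for t \<xi>
    using norm_P_symbol_le [of t \<xi>] divide_right_mono [OF that, of "Gamma \<alpha>"] G by (simp add: C_def)
  show "(\<lambda>n. P_op M U a \<alpha> (fst (z n)) (snd (z n))) \<longlonglongrightarrow> P_op M U a \<alpha> (fst z') (snd z')"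
    unfolding P_op_eq_mult_op
  proof (rule mult_op_tendsto [OF U _ _ _ _ _ \<phi>])
    show "cmod (P_symbol a \<alpha> (fst (z n)) \<xi>) \<le> C" for n \<xi> using K [of n] by (intro bound) simp
    show "cmod (P_symbol a \<alpha> (fst z') \<xi>) \<le> C" for \<xi> by (intro bound) simp
    show "AE \<xi> in M. (\<lambda>n. P_symbol a \<alpha> (fst (z n)) \<xi>) \<longlonglongrightarrow> P_symbol a \<alpha> (fst z') \<xi>"
      unfolding P_symbol_def using \<alpha>
      by (intro AE_I2 tendsto_intros tp isCont_tendsto_compose [OF isCont_mittag_leffler]) auto
  qed (rule P_symbol_measurable)+
qed

lemma P_op_measurable:
  assumes [measurable]: "v \<in> borel_measurable (lebesgue_on {0<..<t})"
  shows "(\<lambda>\<tau>. P_op M U a \<alpha> (t - \<tau>) (v \<tau>)) \<in> borel_measurable (lebesgue_on {0<..<t})"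
proof -
  have "(\<lambda>\<tau>. t - \<tau>) \<in> borel_measurable (lebesgue_on {0<..<t})"
    by (intro measurable_restrict_space1 measurable_completion) simp
  then have "(\<lambda>\<tau>. (t - \<tau>, v \<tau>)) \<in> lebesgue_on {0<..<t} \<rightarrow>\<^sub>M restrict_space borel ({0<..} \<times> UNIV)"
    by (intro measurable_restrict_space2 borel_measurable_Pair assms) auto
  from measurable_compose [OF this borel_measurable_continuous_on_restrict [OF continuous_on_P_op]]
  show ?thesis by simp
qed

lemma integrable_powr_diff_lebesgue_on: "integrable (lebesgue_on {0<..<t}) (\<lambda>\<tau>. (t - \<tau>) powr (\<alpha> - 1))"
  using integrable_powr_diff [OF \<alpha>(1), of t]
  by (simp add: integrable_restrict_space) (subst integrable_completion, auto)

text \<open>An integrable singular kernel times an essentially bounded function dominates the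
  integrand. The second bound reduces \<open>G_op\<close> to the scalar convolution that occurs, for
  \<open>F - F0\<close>, in the hypothesis of the theorem.\<close>

lemma
  assumes v: "v \<in> borel_measurable (lebesgue_on {0<..<t})"
    and C: "AE \<tau> in lebesgue_on {0<..<t}. norm (v \<tau>) \<le> C"
  shows P_op_integrable: "integrable (lebesgue_on {0<..<t}) (\<lambda>\<tau>. P_op M U a \<alpha> (t - \<tau>) (v \<tau>))"
    and norm_G_op_le: "norm (G_op M U a \<alpha> v t)
      \<le> (LINT \<tau>:{0<..<t}|lebesgue. (t - \<tau>) powr (\<alpha> - 1) * norm (v \<tau>)) / Gamma \<alpha>"
proof -
  have G: "0 < Gamma \<alpha>" using \<alpha> by simp
  have [measurable]: "(\<lambda>\<tau>. (t - \<tau>) powr (\<alpha> - 1)) \<in> borel_measurable (lebesgue_on {0<..<t})"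
    using integrable_powr_diff_lebesgue_on by (rule borel_measurable_integrable)
  note v [measurable]
  have i: "integrable (lebesgue_on {0<..<t}) (\<lambda>\<tau>. (t - \<tau>) powr (\<alpha> - 1) * norm (v \<tau>))"
  proof (rule Bochner_Integration.integrable_bound)
    show "integrable (lebesgue_on {0<..<t}) (\<lambda>\<tau>. (t - \<tau>) powr (\<alpha> - 1) * C)"
      by (intro integrable_mult_left integrable_powr_diff_lebesgue_on)
    show "AE \<tau> in lebesgue_on {0<..<t}. norm ((t - \<tau>) powr (\<alpha> - 1) * norm (v \<tau>)) \<le> norm ((t - \<tau>) powr (\<alpha> - 1) * C)"
      using C
    proof eventually_elim
      case (elim \<tau>)
      \<comment> \<open>\<open>C\<close> is not assumed nonnegative, hence the absolute
        value.\<close>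
      then have "norm (v \<tau>) \<le> \<bar>C\<bar>" by linarith
      then show ?case by (simp add: abs_mult mult_left_mono)
    qed
  qed simp
  then have i': "integrable (lebesgue_on {0<..<t}) (\<lambda>\<tau>. (t - \<tau>) powr (\<alpha> - 1) * norm (v \<tau>) / Gamma \<alpha>)"
    by simp
  have le: "norm (P_op M U a \<alpha> (t - \<tau>) (v \<tau>)) \<le> (t - \<tau>) powr (\<alpha> - 1) * norm (v \<tau>) / Gamma \<alpha>" for \<tau>
    using norm_P_op_le [of "t - \<tau>" "v \<tau>"] by simp
  show int: "integrable (lebesgue_on {0<..<t}) (\<lambda>\<tau>. P_op M U a \<alpha> (t - \<tau>) (v \<tau>))"
    using P_op_measurable [OF v] by (rule Bochner_Integration.integrable_bound [OF i'])
      (use le G in \<open>auto intro!: AE_I2 order_trans [OF le]\<close>)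
  have "norm (G_op M U a \<alpha> v t) \<le> (LINT \<tau>|lebesgue_on {0<..<t}. norm (P_op M U a \<alpha> (t - \<tau>) (v \<tau>)))"
    unfolding G_op_eq_lebesgue_on by (rule integral_norm_bound)
  also have "\<dots> \<le> (LINT \<tau>|lebesgue_on {0<..<t}. (t - \<tau>) powr (\<alpha> - 1) * norm (v \<tau>) / Gamma \<alpha>)"
    by (intro integral_mono integrable_norm int i' le)
  finally show "norm (G_op M U a \<alpha> v t)
      \<le> (LINT \<tau>:{0<..<t}|lebesgue. (t - \<tau>) powr (\<alpha> - 1) * norm (v \<tau>)) / Gamma \<alpha>"
    by (simp add: set_lebesgue_integral_def integral_restrict_space)
qed

lemma G_op_diff:
  assumes "v \<in> borel_measurable (lebesgue_on {0<..<t})" "AE \<tau> in lebesgue_on {0<..<t}. norm (v \<tau>) \<le> C"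
    and "w \<in> borel_measurable (lebesgue_on {0<..<t})" "AE \<tau> in lebesgue_on {0<..<t}. norm (w \<tau>) \<le> C'"
  shows "G_op M U a \<alpha> (\<lambda>\<tau>. v \<tau> - w \<tau>) t = G_op M U a \<alpha> v t - G_op M U a \<alpha> w t"
  unfolding G_op_eq_lebesgue_on P_op_diff
  by (rule Bochner_Integration.integral_diff) (rule P_op_integrable assms)+

text \<open>Where \<open>a \<xi> \<noteq> 0\<close>, the argument
  \<open>a \<xi> * t powr \<alpha>\<close> tends to infinity in modulus and the symbol decays; it is
  bounded by 1 throughout. The limit is taken along sequences because the strong convergence result
  is sequential.\<close>

lemma S_op_tendsto_0:
  assumes "AE \<xi> in M. a \<xi> \<noteq> 0"
  shows "((\<lambda>t. S_op M U a \<alpha> t \<phi>) \<longlongrightarrow> 0) at_top"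
proof (rule tendsto_at_topI_sequentially)
  fix T :: "nat \<Rightarrow> real"
  assume T: "filterlim T at_top sequentially"
  have "filterlim (\<lambda>t. t powr \<alpha>) at_top at_top" using \<alpha> by real_asymp
  then have Ta: "filterlim (\<lambda>n. T n powr \<alpha>) at_top sequentially"
    using T by (rule filterlim_compose)
  have "(\<lambda>n. S_op M U a \<alpha> (T n) \<phi>) \<longlonglongrightarrow> mult_op M U (\<lambda>_. 0) \<phi>"
    unfolding S_op_eq_mult_op
  proof (rule mult_op_tendsto [OF U _ _ _ _ _ tendsto_const])
    show "cmod (mittag_leffler \<alpha> 1 (\<i> * of_real (a \<xi> * T n powr \<alpha>))) \<le> 1" for n \<xi>
      by (rule norm_mittag_leffler_1_imag_le [OF \<alpha>])
    show "AE \<xi> in M. (\<lambda>n. mittag_leffler \<alpha> 1 (\<i> * of_real (a \<xi> * T n powr \<alpha>))) \<longlonglongrightarrow> 0"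
      using assms
    proof eventually_elim
      case (elim \<xi>)
      have "filterlim (\<lambda>n. \<bar>a \<xi>\<bar> * T n powr \<alpha>) at_top sequentially"
        using elim by (intro filterlim_tendsto_pos_mult_at_top [OF tendsto_const] Ta) auto
      then have "filterlim (\<lambda>n. a \<xi> * T n powr \<alpha>) at_infinity sequentially"
        by (simp add: filterlim_at_infinity_conv_norm_at_top abs_mult)
      then show ?case by (rule filterlim_compose [OF tendsto_mittag_leffler_1_imag [OF \<alpha>]])
    qed
  qed (measurable, auto)
  moreover have "mult_op M U (\<lambda>_. 0) \<phi> = 0"
    using norm_mult_op_le [OF U, of "\<lambda>_. 0" 0 \<phi>] by simp
  ultimately show "(\<lambda>n. S_op M U a \<alpha> (T n) \<phi>) \<longlonglongrightarrow> 0" by simp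
qed

text \<open>Tested against a vector \<open>v\<close>, the Bochner integral becomes a double
  integral. After Fubini the inner time integral is the scalar identity, with the factor
  \<open>a \<xi>\<close> contained in \<open>F0\<close> in the role of \<open>y\<close>.\<close>

lemma G_op_const:
  assumes M: "finite_measure M" and t: "0 \<le> t"
    and L: "(\<lambda>\<xi>. of_real (a \<xi>) * Uinv M U \<psi> \<xi>) \<in> L2 M"
    and F0: "F0 = U (\<lambda>\<xi>. of_real (a \<xi>) * Uinv M U \<psi> \<xi>)"
  shows "\<i> *\<^sub>C G_op M U a \<alpha> (\<lambda>_. F0) t = S_op M U a \<alpha> t \<psi> - \<psi>"
proof (rule cinner_eqI)
  fix v
  define k where "k = Uinv M U \<psi>"
  define h where "h = Uinv M U v"
  define q where "q = (\<lambda>\<xi>. of_real (a \<xi>) * k \<xi>)"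
  define g where "g = (\<lambda>\<xi>. mittag_leffler \<alpha> 1 (\<i> * of_real (a \<xi> * t powr \<alpha>)))"
  define W where "W = (\<lambda>\<tau> \<xi>. of_real (indicator {0<..<t} \<tau>) * P_symbol a \<alpha> (t - \<tau>) \<xi> * (q \<xi> * cnj (h \<xi>)))"
  interpret finite_measure M by (rule M)
  interpret pair_sigma_finite lborel M ..
  have kL: "k \<in> L2 M" and hL: "h \<in> L2 M" and qL: "q \<in> L2 M"
    using L Uinv_L2 [OF U] by (auto simp: k_def h_def q_def)
  have Uk: "U k = \<psi>" and Uh: "U h = v" by (simp_all add: k_def h_def U_Uinv [OF U])
  have qh: "integrable M (\<lambda>\<xi>. q \<xi> * cnj (h \<xi>))" by (rule L2_mult_integrable [OF qL hL])
  then have [measurable]: "(\<lambda>\<xi>. q \<xi> * cnj (h \<xi>)) \<in> borel_measurable M" by auto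
  have [measurable]: "case_prod W \<in> borel_measurable (lborel \<Otimes>\<^sub>M M)"
    unfolding W_def P_symbol_def by measurable
  \<comment> \<open>The majorant is the product of the integrable time kernel and the integrable
    function \<open>cmod (q \<xi> * cnj (h \<xi>))\<close>.\<close>
  have W: "integrable (lborel \<Otimes>\<^sub>M M) (case_prod W)"
  proof (rule Bochner_Integration.integrable_bound)
    let ?B = "\<lambda>z. indicator {0<..<t} (fst z) * (t - fst z) powr (\<alpha> - 1) / Gamma \<alpha> * cmod (q (snd z) * cnj (h (snd z)))"
    show "integrable (lborel \<Otimes>\<^sub>M M) ?B"
    proof (rule Fubini_integrable)
      have "integrable lborel (\<lambda>\<tau>. indicator {0<..<t} \<tau> * (t - \<tau>) powr (\<alpha> - 1) / Gamma \<alpha> * (LINT \<xi>|M. cmod (q \<xi> * cnj (h \<xi>))))"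
        using integrable_powr_diff [OF \<alpha>(1), of t] by (intro integrable_mult_left integrable_divide)
      then show "integrable lborel (\<lambda>\<tau>. LINT \<xi>|M. norm (?B (\<tau>, \<xi>)))"
        using \<alpha> by (simp add: abs_mult)
      show "AE \<tau> in lborel. integrable M (\<lambda>\<xi>. ?B (\<tau>, \<xi>))"
        using qh by (intro AE_I2) (simp del: norm_mult)
    qed measurable
    show "AE z in lborel \<Otimes>\<^sub>M M. norm (case_prod W z) \<le> norm (?B z)"
    proof (intro AE_I2)
      fix z :: "real \<times> 'w"
      have "indicator {0<..<t} (fst z) * cmod (q (snd z) * cnj (h (snd z))) * cmod (P_symbol a \<alpha> (t - fst z) (snd z))
        \<le> indicator {0<..<t} (fst z) * cmod (q (snd z) * cnj (h (snd z))) * ((t - fst z) powr (\<alpha> - 1) / Gamma \<alpha>)"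
        by (intro mult_left_mono norm_P_symbol_le) auto
      then show "norm (case_prod W z) \<le> norm (?B z)"
        using \<alpha> by (simp add: W_def split_beta norm_mult abs_mult mult_ac)
    qed
  qed measurable
  have P: "cinner (P_op M U a \<alpha> (t - \<tau>) F0) v = (LINT \<xi>|M. P_symbol a \<alpha> (t - \<tau>) \<xi> * (q \<xi> * cnj (h \<xi>)))" for \<tau>
  proof -
    have "P_op M U a \<alpha> (t - \<tau>) F0 = U (\<lambda>\<xi>. P_symbol a \<alpha> (t - \<tau>) \<xi> * q \<xi>)"
      unfolding P_op_eq_mult_op F0 k_def [symmetric] q_def [symmetric]
      by (rule mult_op_U [OF U P_symbol_measurable norm_P_symbol_le qL])
    then show ?thesis
      using cinner_U [OF U L2_mult_bounded [OF qL P_symbol_measurable norm_P_symbol_le] hL, of "t - \<tau>"]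
      by (simp add: Uh mult.assoc)
  qed
  have "cinner (G_op M U a \<alpha> (\<lambda>_. F0) t) v = (LINT \<tau>|lebesgue_on {0<..<t}. cinner (P_op M U a \<alpha> (t - \<tau>) F0) v)"
    unfolding G_op_eq_lebesgue_on
    by (rule integral_bounded_linear [symmetric, OF bounded_linear_cinner_left P_op_integrable [where C = "norm F0"]]) auto
  also have "\<dots> = (LINT \<tau>|lebesgue. LINT \<xi>|M. W \<tau> \<xi>)"
    unfolding P by (simp add: integral_restrict_space W_def mult.assoc scaleR_conv_of_real)
  also have "\<dots> = (LINT \<tau>|lborel. LINT \<xi>|M. W \<tau> \<xi>)"
    by (rule integral_completion) measurable
  also have "\<dots> = (LINT \<xi>|M. LINT \<tau>|lborel. W \<tau> \<xi>)"
    by (rule Fubini_integral [symmetric, OF W])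
  finally have G: "cinner (G_op M U a \<alpha> (\<lambda>_. F0) t) v = (LINT \<xi>|M. LINT \<tau>|lborel. W \<tau> \<xi>)" .
  \<comment> \<open>The factor \<open>a \<xi>\<close> moves from \<open>q\<close> to the time
    kernel, which leaves \<open>k\<close>, the representative of \<psi>.\<close>
  have inner: "\<i> * (LINT \<tau>|lborel. W \<tau> \<xi>) = (g \<xi> - 1) * (k \<xi> * cnj (h \<xi>))" for \<xi>
  proof -
    have "\<i> * (LINT \<tau>|lborel. W \<tau> \<xi>) = (LINT \<tau>|lborel. \<i> * of_real (a \<xi>) * (of_real (indicator {0<..<t} \<tau> * (t - \<tau>) powr (\<alpha> - 1)) *
      mittag_leffler \<alpha> \<alpha> (\<i> * of_real (a \<xi> * (t - \<tau>) powr \<alpha>))) * (k \<xi> * cnj (h \<xi>)))"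
      by (subst integral_mult_right_zero [symmetric], rule Bochner_Integration.integral_cong)
        (auto simp: W_def P_symbol_def q_def)
    also have "\<dots> = (g \<xi> - 1) * (k \<xi> * cnj (h \<xi>))"
      using integral_mittag_leffler_powr_diff [OF \<alpha> t, of "a \<xi>"]
      by (subst integral_mult_left_zero) (simp add: g_def)
    finally show ?thesis .
  qed
  have gm: "g \<in> borel_measurable M" unfolding g_def by measurable
  have gb: "cmod (g \<xi>) \<le> 1" for \<xi> unfolding g_def by (rule norm_mittag_leffler_1_imag_le [OF \<alpha>])
  have gk: "(\<lambda>\<xi>. g \<xi> * k \<xi>) \<in> L2 M" by (rule L2_mult_bounded [OF kL gm gb])
  have "S_op M U a \<alpha> t \<psi> - \<psi> = U (\<lambda>\<xi>. g \<xi> * k \<xi> - k \<xi>)"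
    unfolding U_diff [OF U gk kL] Uk by (simp add: S_op_eq_mult_op mult_op_def g_def k_def)
  then have "cinner (S_op M U a \<alpha> t \<psi> - \<psi>) v = (LINT \<xi>|M. (g \<xi> - 1) * (k \<xi> * cnj (h \<xi>)))"
    using cinner_U [OF U L2_diff [OF gk kL] hL] by (simp add: Uh algebra_simps)
  also have "\<dots> = \<i> * cinner (G_op M U a \<alpha> (\<lambda>_. F0) t) v"
    unfolding G inner [symmetric] by simp
  finally show "cinner (\<i> *\<^sub>C G_op M U a \<alpha> (\<lambda>_. F0) t) v = cinner (S_op M U a \<alpha> t \<psi> - \<psi>) v"
    by (simp add: cinner_scaleC_left)
qed

end

section \<open>Injectivity of the operator and the limit of the solution\<close>

text \<open>The indicator of the zero set of \<open>a\<close> is square-integrable because the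
  measure is finite, and \<open>U\<close> maps it into the kernel of \<open>A\<close>; injectivity
  makes it vanish almost everywhere.\<close>

lemma spectral_representation_AE_nonzero:
  fixes D :: "'h::{complex_hilbert, second_countable_topology} set"
  assumes A: "linear_operator_on D A" "inj_on A D" and s: "spectral_representation M U a D A"
  shows "AE \<xi> in M. a \<xi> \<noteq> 0"
proof -
  have M: "finite_measure M" and U: "unitary_L2 M U" and a [measurable]: "a \<in> borel_measurable M"
    and D: "\<And>\<psi>. \<psi> \<in> D \<longleftrightarrow> (\<lambda>\<xi>. complex_of_real (a \<xi>) * Uinv M U \<psi> \<xi>) \<in> L2 M"
    and AU: "\<And>\<psi>. \<psi> \<in> D \<Longrightarrow> A \<psi> = U (\<lambda>\<xi>. complex_of_real (a \<xi>) * Uinv M U \<psi> \<xi>)"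
    using s by (auto simp: spectral_representation_def)
  interpret finite_measure M by (rule M)
  define h :: "_ \<Rightarrow> complex" where "h = (\<lambda>\<xi>. of_real (indicator {0} (a \<xi>)))"
  have [measurable]: "h \<in> borel_measurable M" unfolding h_def by measurable
  have hL: "h \<in> L2 M"
    unfolding L2_def using integrable_const_bound [of "\<lambda>\<xi>. (cmod (h \<xi>))\<^sup>2" 1]
    by (auto simp: h_def indicator_def)
  have zL: "(\<lambda>_. 0) \<in> L2 M" by (simp add: L2_def)
  have [measurable]: "Uinv M U (U h) \<in> borel_measurable M" using Uinv_L2 [OF U] by (auto simp: L2_def)
  have ae: "AE \<xi> in M. complex_of_real (a \<xi>) * Uinv M U (U h) \<xi> = 0"
    using Uinv_U [OF U hL] by eventually_elim (auto simp: h_def indicator_def)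
  then have aL: "(\<lambda>\<xi>. complex_of_real (a \<xi>) * Uinv M U (U h) \<xi>) \<in> L2 M"
    by (intro L2_AE_cong [OF zL]) auto
  have c0: "0 *\<^sub>C z = 0" for z :: 'h using scaleC_of_real [of 0 z] by simp
  have U0: "U (\<lambda>_. 0) = 0" using U_cmult [OF U zL, of 0] by (simp add: c0)
  have Uh: "U h \<in> D" using aL by (simp add: D)
  have "A (U h) = 0" unfolding AU [OF Uh] U0 [symmetric] using ae by (simp add: U_eq_iff_AE [OF U aL zL])
  moreover have "0 \<in> D" and "A 0 = 0"
  proof -
    show "0 \<in> D" using A(1) by (simp add: linear_operator_on_def)
    then have "A (0 *\<^sub>C 0) = 0 *\<^sub>C A 0" using A(1) unfolding linear_operator_on_def by blast
    then show "A 0 = 0" by (simp add: c0)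
  qed
  ultimately have "U h = U (\<lambda>_. 0)" using inj_onD [OF A(2), of "U h" 0] Uh U0 by simp
  then have "AE \<xi> in M. h \<xi> = 0" by (simp add: U_eq_iff_AE [OF U hL zL])
  then show ?thesis by eventually_elim (auto simp: h_def)
qed

theorem theoremD3:
  fixes \<alpha> :: real
    and D :: "'h::{complex_hilbert, second_countable_topology} set"
    and A :: "'h \<Rightarrow> 'h"
    and M :: "'w measure"
    and U :: "('w \<Rightarrow> complex) \<Rightarrow> 'h"
    and a :: "'w \<Rightarrow> real"
    and x F0 :: 'h
    and F u :: "real \<Rightarrow> 'h"
  assumes "0 < \<alpha>" and "\<alpha> < 1"
    and "selfadjoint_on D A" and "inj_on A D"
    and "spectral_representation M U a D A"
    and "x \<in> A ` D"
    and "F \<in> Linf_pos"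
    and "mild_solution M U a \<alpha> x F u"
    and "F0 \<in> A ` D"
    and "((\<lambda>t. LINT \<tau>:{0<..<t}|lebesgue. (t - \<tau>) powr (\<alpha> - 1) * norm (F \<tau> - F0))
           \<longlongrightarrow> 0) at_top"
  shows "(u \<longlongrightarrow> - inv_into D A F0) at_top"
proof -
  note \<alpha> = assms(1,2)
  have M: "finite_measure M" and U: "unitary_L2 M U" and a: "a \<in> borel_measurable M"
    using assms(5) by (auto simp: spectral_representation_def)
  have nz: "AE \<xi> in M. a \<xi> \<noteq> 0"
    using spectral_representation_AE_nonzero assms(3,4,5) by (auto simp: selfadjoint_on_def)
  \<comment> \<open>\<psi> is the inverse image of \<open>F0\<close> under \<open>A\<close>; the
    limit to be shown is \<open>- \<psi>\<close>.\<close>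
  obtain \<psi> where \<psi>: "\<psi> \<in> D" "F0 = A \<psi>" using assms(9) by auto
  have inv: "inv_into D A F0 = \<psi>" using \<psi> assms(4) by simp
  have L: "(\<lambda>\<xi>. complex_of_real (a \<xi>) * Uinv M U \<psi> \<xi>) \<in> L2 M"
    and F0: "F0 = U (\<lambda>\<xi>. complex_of_real (a \<xi>) * Uinv M U \<psi> \<xi>)"
    using assms(5) \<psi> by (auto simp: spectral_representation_def)
  obtain C where Fm: "F \<in> borel_measurable (lebesgue_on {0<..})" and C: "AE \<tau> in lebesgue_on {0<..}. norm (F \<tau>) \<le> C"
    using assms(7) by (auto simp: Linf_pos_def)
  have Fm': "F \<in> borel_measurable (lebesgue_on {0<..<t})" for t
    using Fm by (rule measurable_restrict_mono) auto
  have C': "AE \<tau> in lebesgue_on {0<..<t}. norm (F \<tau>) \<le> C" for t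
    using C by (simp add: AE_restrict_space_iff) (auto elim: eventually_mono)
  have Fd: "(\<lambda>\<tau>. F \<tau> - F0) \<in> borel_measurable (lebesgue_on {0<..<t})" for t
    using Fm' by measurable
  have Cd: "AE \<tau> in lebesgue_on {0<..<t}. norm (F \<tau> - F0) \<le> C + norm F0" for t
    using C' by eventually_elim (auto intro: order_trans [OF norm_triangle_ineq4])
  define R where "R = (\<lambda>t. \<i> *\<^sub>C G_op M U a \<alpha> (\<lambda>\<tau>. F \<tau> - F0) t)"
  \<comment> \<open>Splitting \<open>F\<close> into \<open>F0\<close> and \<open>F - F0\<close>: the
    constant part contributes \<open>S \<psi> - \<psi>\<close>, the rest is
    \<open>R\<close>.\<close>
  have eq: "u t = S_op M U a \<alpha> t x + (S_op M U a \<alpha> t \<psi> - \<psi> + R t)" if "0 \<le> t" for t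
  proof -
    interpret bounded_linear "\<lambda>z::'h. \<i> *\<^sub>C z" by (rule bounded_linear_scaleC)
    have "G_op M U a \<alpha> F t = G_op M U a \<alpha> (\<lambda>_. F0) t + G_op M U a \<alpha> (\<lambda>\<tau>. F \<tau> - F0) t"
      using G_op_diff [OF U a \<alpha> Fm' C', of "\<lambda>_. F0" t "norm F0"] by simp
    then have "\<i> *\<^sub>C G_op M U a \<alpha> F t = S_op M U a \<alpha> t \<psi> - \<psi> + R t"
      using G_op_const [OF U a \<alpha> M that L F0] by (simp add: add R_def)
    then show ?thesis using assms(8) that by (simp add: mild_solution_def)
  qed
  \<comment> \<open>The norm of \<open>R t\<close> is at most the integral in the last hypothesis
    divided by \<open>Gamma \<alpha>\<close>.\<close>
  have "(R \<longlongrightarrow> 0) at_top"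
  proof (rule Lim_null_comparison)
    show "((\<lambda>t. (LINT \<tau>:{0<..<t}|lebesgue. (t - \<tau>) powr (\<alpha> - 1) * norm (F \<tau> - F0)) / Gamma \<alpha>) \<longlongrightarrow> 0) at_top"
      by (rule tendsto_divide_zero [OF assms(10)])
    show "\<forall>\<^sub>F t in at_top. norm (R t) \<le> (LINT \<tau>:{0<..<t}|lebesgue. (t - \<tau>) powr (\<alpha> - 1) * norm (F \<tau> - F0)) / Gamma \<alpha>"
      using norm_G_op_le [OF U a \<alpha> Fd Cd] by (simp add: R_def norm_scaleC)
  qed
  \<comment> \<open>Both orbits under S, of \<open>x\<close> and of \<psi>, tend to 0, so only
    \<open>- \<psi>\<close> remains.\<close>
  then have "((\<lambda>t. S_op M U a \<alpha> t x + (S_op M U a \<alpha> t \<psi> - \<psi> + R t)) \<longlongrightarrow> 0 + (0 - \<psi> + 0)) at_top"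
    by (intro tendsto_intros S_op_tendsto_0 [OF U a \<alpha> nz])
  then have "((\<lambda>t. S_op M U a \<alpha> t x + (S_op M U a \<alpha> t \<psi> - \<psi> + R t)) \<longlongrightarrow> - \<psi>) at_top" by simp
  moreover have "\<forall>\<^sub>F t in at_top. S_op M U a \<alpha> t x + (S_op M U a \<alpha> t \<psi> - \<psi> + R t) = u t"
    using eventually_ge_at_top [of 0] by eventually_elim (simp add: eq)
  ultimately show ?thesis
    unfolding inv by (rule Lim_transform_eventually)
qed

end
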